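(* Let $d\ge 1$, $\phi:\{-1,1\}^d\to\{-1,1\}$, let $\varepsilon=(\varepsilon_n)_{n\in\mathbf{Z}}$ be a coin-tossing sequence and $H_n=\phi(\varepsilon_{n-d},\dots,\varepsilon_{n-1})$, $H\varepsilon=(H_n\varepsilon_n)_{n\in\mathbf{Z}}$. Let $M$, $\mathcal{C}$ and the measurable map $F:\{-1,1\}^{-\mathbf{N}}\to\mathcal{C}$ be as described in the context. For each $A\in\mathcal{C}$, number the elements of $A$ from $1$ to $M$. For every $n\in\mathbf{Z}$, let $N_n$ be the number of $(\varepsilon_{n-d+1},\dots,\varepsilon_n)$ in $F((H\varepsilon)_{n]})$ (almost surely this $d$-tuple belongs to that set). Then for every $n\in\mathbf{Z}$: (i) $N_n$ is uniformly distributed on $\{1,\dots,M\}$; (ii) $N_n$ is independent of $\mathcal{F}_\infty^{H\varepsilon}$; (iii) $\mathcal{F}_n^{\varepsilon}=\mathcal{F}_n^{H\varepsilon}\vee\sigma(N_n)$.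
   Context: $-\mathbf{N}=\{\dots,-2,-1,0\}$. A coin-tossing sequence is a family of independent random variables, each of law $(\delta_{-1}+\delta_1)/2$. For $x\in\{-1,1\}^{\mathbf{Z}}$, $x_{n]}=(x_{n+k})_{k\in-\mathbf{N}}$. For a process $\xi$, $\mathcal{F}_n^{\xi}=\sigma((\xi_k)_{k\le n})$ and $\mathcal{F}_\infty^{\xi}=\sigma((\xi_k)_{k\in\mathbf{Z}})$; all $\sigma$-fields are completed. Let $E_d=\{-1,1\}^d$ and, for $\alpha\in\{-1,1\}$ (also written $-,+$), $f_\alpha:E_d\to E_d$, $f_\alpha(x_1,\dots,x_d)=(x_2,\dots,x_d,\alpha\,\phi(x_1,\dots,x_d))$. Elements $a,b\in E_d$ are accordable if some composite $f_{\alpha_l}\circ\cdots\circ f_{\alpha_1}$ ($\alpha_i\in\{-1,1\}$) takes the same value at $a$ and $b$. $M$ denotes the maximal number of pairwise non-accordable elements of $E_d$. On the set $\mathcal{P}(E_d)$ of subsets of $E_d$ consider the transition kernel $q(A,\cdot)=\frac12(\delta_{f_+(A)}+\delta_{f_-(A)})$ (direct images). $\mathcal{C}$ is the set of recurrent states of this chain having exactly $M$ elements (it is a recurrent class). The map $F:\{-1,1\}^{-\mathbf{N}}\to\mathcal{C}$ is the measurable map (it exists and is unique up to null sets for the uniform product law) such that, for every Markov chain $(X_n)_{n\in\mathbf{Z}}$ on $\mathcal{C}$ with kernel $q$ governed by a coin-tossing sequence $(\eta_n)_{n\in\mathbf{Z}}$, i.e. $X_n=f_{\eta_n}(X_{n-1})$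 for all $n$, one has almost surely $X_n=F(\eta_{n]})$ for all $n\in\mathbf{Z}$. *)

theory Defs
  imports "HOL-Probability.Probability"
begin

section \<open>The maps on the discrete cube\<close>

text \<open>A point \<open>(x_1, ..., x_d)\<close> of the cube is the list \<open>[x_1, ..., x_d]\<close>.\<close>

definition cube :: "nat \<Rightarrow> int list set" where
  "cube d = {x. length x = d \<and> set x \<subseteq> {-1, 1}}"

definition shift_map :: "(int list \<Rightarrow> int) \<Rightarrow> int \<Rightarrow> int list \<Rightarrow> int list" where
  "shift_map \<phi> \<alpha> x = tl x @ [\<alpha> * \<phi> x]"

text \<open>\<^term>\<open>fold (shift_map \<phi>) [\<alpha>1, \<alpha>2]\<close> applies \<open>\<alpha>1\<close> first.\<close>

definition accordable :: "(int list \<Rightarrow> int) \<Rightarrow> int list \<Rightarrow> int list \<Rightarrow> bool" where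
  "accordable \<phi> a b \<longleftrightarrow>
     (\<exists>\<alpha>s. set \<alpha>s \<subseteq> {-1, 1} \<and> fold (shift_map \<phi>) \<alpha>s a = fold (shift_map \<phi>) \<alpha>s b)"

definition max_nonaccordable :: "nat \<Rightarrow> (int list \<Rightarrow> int) \<Rightarrow> nat" where
  "max_nonaccordable d \<phi> =
     Max {card A | A. A \<subseteq> cube d \<and> pairwise (\<lambda>a b. \<not> accordable \<phi> a b) A}"


section \<open>Markov chains\<close>

text \<open>
  \<open>first_passage K y n x\<close> is the probability that the chain with kernel \<open>K\<close> started at \<open>x\<close>
  visits \<open>y\<close> at time \<open>n + 1\<close> for the first time (time 0 not counted). A state is recurrent
  if the chain started there returns to it in finite time with probability one.
\<close>

primrec first_passage :: "('s \<Rightarrow> 's pmf) \<Rightarrow> 's \<Rightarrow> nat \<Rightarrow> 's \<Rightarrow> real" where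
  "first_passage K y 0 x = pmf (K x) y"
| "first_passage K y (Suc n) x =
     measure_pmf.expectation (K x) (\<lambda>z. if z = y then 0 else first_passage K y n z)"

definition recurrent :: "('s \<Rightarrow> 's pmf) \<Rightarrow> 's \<Rightarrow> bool" where
  "recurrent K x \<longleftrightarrow> (\<lambda>n. first_passage K x n x) sums 1"

definition set_kernel :: "(int list \<Rightarrow> int) \<Rightarrow> int list set \<Rightarrow> int list set pmf" where
  "set_kernel \<phi> A = map_pmf (\<lambda>\<alpha>. shift_map \<phi> \<alpha> ` A) (pmf_of_set {-1, 1})"

definition recurrent_class :: "nat \<Rightarrow> (int list \<Rightarrow> int) \<Rightarrow> int list set set" where
  "recurrent_class d \<phi> =
     {A \<in> Pow (cube d). recurrent (set_kernel \<phi>) A \<and> card A = max_nonaccordable d \<phi>}"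

definition markov_chain ::
    "'a measure \<Rightarrow> 's set \<Rightarrow> ('s \<Rightarrow> 's pmf) \<Rightarrow> (int \<Rightarrow> 'a \<Rightarrow> 's) \<Rightarrow> bool" where
  "markov_chain P S K X \<longleftrightarrow>
     prob_space P \<and>
     (\<forall>n. X n \<in> P \<rightarrow>\<^sub>M count_space S) \<and>
     (\<forall>n. \<forall>s\<in>S. AE \<omega> in P.
        real_cond_exp P (sigma (space P) {X k -` B \<inter> space P | k B. k \<le> n - 1})
          (indicator {\<omega> \<in> space P. X n \<omega> = s}) \<omega>
        = pmf (K (X (n - 1) \<omega>)) s)"


section \<open>Coin-tossing sequences and completed sigma-fields\<close>

definition coin_tossing :: "'a measure \<Rightarrow> (int \<Rightarrow> 'a \<Rightarrow> int) \<Rightarrow> bool" where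
  "coin_tossing P \<eta> \<longleftrightarrow>
     prob_space P \<and>
     prob_space.indep_vars P (\<lambda>_. count_space {-1, 1}) \<eta> UNIV \<and>
     (\<forall>n. distr P (count_space UNIV) (\<eta> n) = measure_pmf (pmf_of_set {-1, 1}))"

text \<open>
  The probability space itself need not be complete: sigma-fields are completed by the
  null sets of its completion, so they live on \<^term>\<open>completion P\<close>.
\<close>

definition completed_field :: "'a measure \<Rightarrow> 'a set set \<Rightarrow> 'a set set" where
  "completed_field P G = sigma_sets (space P) (G \<union> null_sets (completion P))"

definition var_field :: "'a measure \<Rightarrow> ('a \<Rightarrow> 's) \<Rightarrow> 'a set set" where
  "var_field P Y = completed_field P {Y -` B \<inter> space P | B. True}"

definition past_field :: "'a measure \<Rightarrow> (int \<Rightarrow> 'a \<Rightarrow> 's) \<Rightarrow> int \<Rightarrow> 'a set set" where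
  "past_field P \<xi> n = completed_field P {\<xi> k -` B \<inter> space P | k B. k \<le> n}"

definition full_field :: "'a measure \<Rightarrow> (int \<Rightarrow> 'a \<Rightarrow> 's) \<Rightarrow> 'a set set" where
  "full_field P \<xi> = completed_field P {\<xi> k -` B \<inter> space P | k B. True}"

definition join_field :: "'a measure \<Rightarrow> 'a set set \<Rightarrow> 'a set set \<Rightarrow> 'a set set" where
  "join_field P G H = completed_field P (G \<union> H)"


section \<open>The map from the past of the coin tosses to the recurrent class\<close>

definition past :: "(int \<Rightarrow> int) \<Rightarrow> int \<Rightarrow> int \<Rightarrow> int" where
  "past x n = (\<lambda>k\<in>{..0}. x (n + k))"

definition past_space :: "(int \<Rightarrow> int) measure" where
  "past_space = PiM {..0} (\<lambda>_. count_space {-1, 1})"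

text \<open>
  The defining property of the map ranges over all chains on all probability spaces. It only
  depends on the joint law of the chain and the coin tosses, which can be realised on the
  space of paths of pairs (coin toss, state); hence it suffices to let \<open>Q\<close> range over the
  measures on that type.
\<close>

definition is_past_map ::
    "nat \<Rightarrow> (int list \<Rightarrow> int) \<Rightarrow> ((int \<Rightarrow> int) \<Rightarrow> int list set) \<Rightarrow> bool" where
  "is_past_map d \<phi> F \<longleftrightarrow>
     F \<in> past_space \<rightarrow>\<^sub>M count_space (recurrent_class d \<phi>) \<and>
     (\<forall>(Q :: (int \<Rightarrow> int \<times> int list set) measure) X \<eta>.
        markov_chain Q (recurrent_class d \<phi>) (set_kernel \<phi>) X \<and>
        coin_tossing Q \<eta> \<and>
        (AE \<omega> in Q. \<forall>n. X n \<omega> = shift_map \<phi> (\<eta> n \<omega>) ` X (n - 1) \<omega>)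
        \<longrightarrow> (AE \<omega> in Q. \<forall>n. X n \<omega> = F (past (\<lambda>k. \<eta> k \<omega>) n)))"


section \<open>The transformed sequence and the numbering\<close>

definition window :: "nat \<Rightarrow> (int \<Rightarrow> 'a \<Rightarrow> int) \<Rightarrow> int \<Rightarrow> 'a \<Rightarrow> int list" where
  "window d \<epsilon> n \<omega> = map (\<lambda>k. \<epsilon> k \<omega>) [n - int d + 1..n]"

definition twist ::
    "nat \<Rightarrow> (int list \<Rightarrow> int) \<Rightarrow> (int \<Rightarrow> 'a \<Rightarrow> int) \<Rightarrow> int \<Rightarrow> 'a \<Rightarrow> int" where
  "twist d \<phi> \<epsilon> n \<omega> = \<phi> (window d \<epsilon> (n - 1) \<omega>) * \<epsilon> n \<omega>"

definition state_set ::
    "nat \<Rightarrow> (int list \<Rightarrow> int) \<Rightarrow> ((int \<Rightarrow> int) \<Rightarrow> int list set)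
      \<Rightarrow> (int \<Rightarrow> 'a \<Rightarrow> int) \<Rightarrow> int \<Rightarrow> 'a \<Rightarrow> int list set" where
  "state_set d \<phi> F \<epsilon> n \<omega> = F (past (\<lambda>k. twist d \<phi> \<epsilon> k \<omega>) n)"

text \<open>
  Here \<open>num A\<close> is the chosen numbering of \<open>A\<close>. On the null event where the window is not in
  the state set, the value is unspecified.
\<close>

definition state_number ::
    "nat \<Rightarrow> (int list \<Rightarrow> int) \<Rightarrow> ((int \<Rightarrow> int) \<Rightarrow> int list set)
      \<Rightarrow> (int list set \<Rightarrow> int list \<Rightarrow> nat) \<Rightarrow> (int \<Rightarrow> 'a \<Rightarrow> int) \<Rightarrow> int \<Rightarrow> 'a \<Rightarrow> nat" where
  "state_number d \<phi> F num \<epsilon> n \<omega> = num (state_set d \<phi> F \<epsilon> n \<omega>) (window d \<epsilon> n \<omega>)"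

end

theory Submission
  imports Defs
begin

text \<open>
  Write \<open>act w\<close> for the composite of the maps along a word \<open>w\<close> of signs, \<open>Z n\<close> for the window of
  \<open>\<epsilon>\<close> that ends at time \<open>n\<close>, \<open>\<eta>\<close> for the twisted sequence and \<open>M\<close> for the maximal number of
  pairwise non-accordable points.

  The twisted sequence drives the windows: \<open>Z n\<close> is the image of \<open>Z (n - 1)\<close> under the map of the
  letter \<open>\<eta> n\<close>. Moreover \<open>Z a\<close> together with the next \<open>l\<close> twisted tosses is a bijective recoding
  of \<open>d + l\<close> consecutive tosses, hence uniform (\<open>uniform_state_and_future\<close>). So \<open>\<eta>\<close> is again
  coin-tossing, and \<open>Z a\<close> is uniform and independent of the twisted tosses after \<open>a\<close>.

  The combinatorial core is that \<open>M\<close> is the least rank of the maps \<open>act w\<close> (\<open>min_rank\<close>) and that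
  all fibres of a map of least rank have the same size \<open>2 ^ d / M\<close> (\<open>card_sync_class\<close>). The latter
  is an argument that goes back to Friedman's work on road colouring: since the uniform law is
  invariant, preimages of a largest set that can be collapsed to a point are again such sets.

  Words of least rank, called synchronizing, occur almost surely in the past of \<open>\<eta>\<close>. The image of the
  cube under the past of \<open>\<eta>\<close> stabilizes once that past contains such a word; the resulting limit
  sets consist of \<open>M\<close> points, are recurrent states and form a Markov chain governed by \<open>\<eta>\<close>.
  Therefore \<open>F\<close> applied to the past of \<open>\<eta>\<close> is this limit set (\<open>past_map_eq_limit_set\<close>). It contains
  \<open>Z n\<close>, which lies in the image of the cube under any part of the past.

  Now suppose that the last \<open>m\<close> twisted tosses up to time \<open>n\<close> form a synchronizing word \<open>v\<close>. Then
  \<open>Z n\<close> is the image under \<open>v\<close> of \<open>Z (n - m)\<close>, which is uniform and independent of the later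
  twisted tosses. As the fibres of \<open>act v\<close> have equal size, \<open>Z n\<close> is uniform on the limit set
  \<open>act v ` cube d\<close> given all twisted tosses after \<open>n - m\<close>, and letting \<open>m\<close> tend to infinity gives
  the law and the independence of the number (\<open>limit_number_indep\<close>). Finally, every \<open>act w\<close> is
  injective on a limit set, so the number of \<open>Z n\<close> and the past of \<open>\<eta>\<close> determine \<open>Z n\<close>, then
  \<open>Z (n - 1)\<close>, and so on (\<open>past_field_recovered\<close>).
\<close>

section \<open>Words of signs and languages that avoid a factor\<close>

lemma cube_eq: "cube l = {w. set w \<subseteq> {-1, 1} \<and> length w = l}"
  by (auto simp: cube_def)

lemma finite_cube [simp]: "finite (cube l)"
  unfolding cube_eq by (rule finite_lists_length_eq) simp

lemma card_cube [simp]: "card (cube l) = 2 ^ l"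
  unfolding cube_eq by (subst card_lists_length_eq) (auto simp: numeral_2_eq_2)

lemma cube_0 [simp]: "cube 0 = {[]}"
  by (auto simp: cube_def)

lemma cube_append_split:
  "cube (k + l) = (\<lambda>(u, v). u @ v) ` (cube k \<times> cube l)"
proof
  show "cube (k + l) \<subseteq> (\<lambda>(u, v). u @ v) ` (cube k \<times> cube l)"
  proof
    fix w assume w: "w \<in> cube (k + l)"
    then have "take k w \<in> cube k" "drop k w \<in> cube l"
      by (auto simp: cube_def dest: in_set_takeD in_set_dropD)
    then show "w \<in> (\<lambda>(u, v). u @ v) ` (cube k \<times> cube l)"
      by (intro image_eqI[of _ _ "(take k w, drop k w)"]) auto
  qed
qed (auto simp: cube_def)

text \<open>
  Cut a word of length \<open>j * L\<close> into blocks, where \<open>L\<close> is the length of the forbidden factor. Every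
  block has to avoid one of the \<open>2 ^ L\<close> possible values, so the density is at most
  \<open>(1 - 1 / 2 ^ L) ^ j\<close>. The lemma serves twice: the words that are not synchronizing, and the
  paths of the set-valued chain that do not return to their start, are such languages.
\<close>

lemma density_avoiding_factor:
  fixes S :: "int list set"
  assumes prefix: "\<And>u v. u @ v \<in> S \<Longrightarrow> u \<in> S"
    and avoid: "\<And>u v. u @ w @ v \<notin> S"
    and w: "set w \<subseteq> {-1, 1}" "w \<noteq> []"
  shows "(\<lambda>n. real (card (S \<inter> cube n)) / 2 ^ n) \<longlonglongrightarrow> 0"
proof -
  define p where "p n = real (card (S \<inter> cube n)) / 2 ^ n" for n
  define L where "L = length w"
  have L: "L \<ge> 1" using w by (simp add: L_def Suc_le_eq)
  have wL: "w \<in> cube L" using w by (simp add: cube_def L_def)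
  have step: "card (S \<inter> cube (n + k)) \<le> card (S \<inter> cube n) * card T"
    if T: "finite T" and sub: "\<And>u v. u \<in> cube n \<Longrightarrow> v \<in> cube k \<Longrightarrow> u @ v \<in> S \<Longrightarrow> v \<in> T" for n k T
  proof -
    have "S \<inter> cube (n + k) \<subseteq> (\<lambda>(u, v). u @ v) ` ((S \<inter> cube n) \<times> T)"
      using sub prefix by (fastforce simp: cube_append_split)
    then have "card (S \<inter> cube (n + k)) \<le> card ((S \<inter> cube n) \<times> T)"
      using T by (meson finite_Int finite_SigmaI finite_cube finite_imageI card_image_le card_mono order_trans)
    then show ?thesis by (simp add: card_cartesian_product)
  qed
  have p_anti: "p (Suc n) \<le> p n" for n
  proof -
    have "card (S \<inter> cube (n + 1)) \<le> card (S \<inter> cube n) * card (cube 1)"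
      by (rule step) auto
    then have "real (card (S \<inter> cube (n + 1))) \<le> real (card (S \<inter> cube n)) * 2"
      by (metis card_cube of_nat_le_iff of_nat_mult of_nat_numeral power_one_right)
    then show ?thesis by (simp add: p_def field_simps)
  qed
  have p_block: "p (n + L) \<le> p n * (1 - 1 / 2 ^ L)" for n
  proof -
    have "card (S \<inter> cube (n + L)) \<le> card (S \<inter> cube n) * card (cube L - {w})"
      using avoid[of _ "[]"] by (intro step) auto
    also have "card (cube L - {w}) = 2 ^ L - 1"
      using wL by simp
    finally have "real (card (S \<inter> cube (n + L))) \<le> real (card (S \<inter> cube n)) * real (2 ^ L - 1)"
      by (metis of_nat_le_iff of_nat_mult)
    then have *: "real (card (S \<inter> cube (n + L))) \<le> real (card (S \<inter> cube n)) * (2 ^ L - 1)"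
      by (simp add: of_nat_diff)
    have "p (n + L) = real (card (S \<inter> cube (n + L))) / (2 ^ n * 2 ^ L)"
      by (simp add: p_def power_add)
    also have "\<dots> \<le> real (card (S \<inter> cube n)) * (2 ^ L - 1) / (2 ^ n * 2 ^ L)"
      by (intro divide_right_mono *) auto
    also have "\<dots> = p n * (1 - 1 / 2 ^ L)"
      by (simp add: p_def field_simps)
    finally show ?thesis .
  qed
  have p_pow: "p (j * L) \<le> (1 - 1 / 2 ^ L) ^ j" for j
  proof (induction j)
    case 0
    have "card (S \<inter> cube 0) \<le> card {[] :: int list}"
      by (intro card_mono) auto
    then show ?case by (simp add: p_def)
  next
    case (Suc j)
    have "p (Suc j * L) \<le> p (j * L) * (1 - 1 / 2 ^ L)"
      using p_block[of "j * L"] by (simp add: add.commute)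
    also have "\<dots> \<le> (1 - 1 / 2 ^ L) ^ j * (1 - 1 / 2 ^ L)"
      using Suc.IH by (intro mult_right_mono) auto
    finally show ?case by (simp add: mult.commute)
  qed
  have "decseq p" using p_anti by (rule decseq_SucI)
  moreover have "p n \<ge> 0" for n by (simp add: p_def)
  ultimately obtain c where c: "p \<longlonglongrightarrow> c"
    using decseq_convergent[of p 0] by metis
  have "strict_mono (\<lambda>j. j * L)" using L by (simp add: strict_mono_def)
  then have "(\<lambda>j. p (j * L)) \<longlonglongrightarrow> c"
    using LIMSEQ_subseq_LIMSEQ[OF c] by (simp add: o_def)
  moreover have "(\<lambda>j. p (j * L)) \<longlonglongrightarrow> 0"
  proof (rule tendsto_sandwich[where f = "\<lambda>_. 0" and h = "\<lambda>j. (1 - 1 / 2 ^ L) ^ j"])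
    show "(\<lambda>j. (1 - 1 / 2 ^ L) ^ j :: real) \<longlonglongrightarrow> 0"
      by (rule LIMSEQ_realpow_zero) auto
    show "\<forall>\<^sub>F j in sequentially. 0 \<le> p (j * L)"
      by (simp add: p_def)
    show "\<forall>\<^sub>F j in sequentially. p (j * L) \<le> (1 - 1 / 2 ^ L) ^ j"
      using p_pow by simp
  qed simp
  ultimately have "c = 0" by (rule LIMSEQ_unique)
  with c show ?thesis by (simp add: p_def[abs_def])
qed

section \<open>The minimal rank and synchronizing words\<close>

locale cube_automaton =
  fixes d :: nat and \<phi> :: "int list \<Rightarrow> int"
  assumes d_pos: "d \<ge> 1" and \<phi>_range: "\<phi> \<in> cube d \<rightarrow> {-1, 1}"
begin

abbreviation act :: "int list \<Rightarrow> int list \<Rightarrow> int list" where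
  "act w x \<equiv> fold (shift_map \<phi>) w x"

abbreviation "M \<equiv> max_nonaccordable d \<phi>"

text \<open>
  Words act by reading the leftmost letter first, so looking further into the past of a sequence
  means adding a prefix. The rank \<open>M\<close> is the least possible one, by \<open>min_rank\<close> below: the
  points that are left by a synchronizing word cannot be merged any further.
\<close>

definition sync :: "int list \<Rightarrow> bool" where
  "sync w \<longleftrightarrow> set w \<subseteq> {-1, 1} \<and> card (act w ` cube d) = M"

lemma \<phi>_cases: "x \<in> cube d \<Longrightarrow> \<phi> x = -1 \<or> \<phi> x = 1"
  using \<phi>_range by auto

lemma shift_map_cube: "\<alpha> \<in> {-1, 1} \<Longrightarrow> x \<in> cube d \<Longrightarrow> shift_map \<phi> \<alpha> x \<in> cube d"
  using \<phi>_cases[of x] d_pos by (cases x) (auto simp: cube_def shift_map_def)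

lemma act_cube: "set w \<subseteq> {-1, 1} \<Longrightarrow> x \<in> cube d \<Longrightarrow> act w x \<in> cube d"
  by (induction w arbitrary: x) (auto intro: shift_map_cube)

lemma act_image_cube: "set w \<subseteq> {-1, 1} \<Longrightarrow> act w ` cube d \<subseteq> cube d"
  using act_cube by auto

lemma act_append_image: "act (u @ v) ` A = act v ` act u ` A"
  by (auto simp: image_image)

lemma card_act_append_le: "card (act (u @ v) ` cube d) \<le> card (act u ` cube d)"
  unfolding act_append_image by (rule card_image_le) simp

lemma inj_on_nonaccordable:
  assumes "pairwise (\<lambda>a b. \<not> accordable \<phi> a b) A" "set w \<subseteq> {-1, 1}"
  shows "inj_on (act w) A"
  using assms unfolding inj_on_def accordable_def pairwise_def by blast

text \<open>
  The number \<open>M\<close> is the least rank of the maps \<open>act w\<close>. No word can identify two points of a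
  non-accordable set, which gives the lower bound on every rank. Conversely two accordable points in
  an image of least rank could be merged by one more word, which would lower the rank; so such an
  image is non-accordable and has at most \<open>M\<close> points.
\<close>

theorem min_rank:
  shows ex_sync: "\<exists>w. sync w"
    and rank_ge: "\<And>w. set w \<subseteq> {-1, 1} \<Longrightarrow> M \<le> card (act w ` cube d)"
proof -
  let ?words = "\<lambda>w :: int list. set w \<subseteq> {-1, 1}"
  let ?sizes = "{card A | A. A \<subseteq> cube d \<and> pairwise (\<lambda>a b. \<not> accordable \<phi> a b) A}"
  have fin: "finite ?sizes"
    by (rule finite_subset[of _ "card ` Pow (cube d)"]) auto
  have "card {} \<in> ?sizes" by (rule CollectI, rule exI[of _ "{}"]) (simp add: pairwise_def)
  then have ne: "?sizes \<noteq> {}" by blast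
  have "M \<in> ?sizes"
    unfolding max_nonaccordable_def by (rule Max_in[OF fin ne])
  then obtain A where A: "A \<subseteq> cube d" "pairwise (\<lambda>a b. \<not> accordable \<phi> a b) A" "M = card A"
    by blast
  show ge: "M \<le> card (act w ` cube d)" if w: "?words w" for w
  proof -
    have "card A = card (act w ` A)"
      using inj_on_nonaccordable[OF A(2) w] by (simp add: card_image)
    also have "\<dots> \<le> card (act w ` cube d)"
      using A(1) by (intro card_mono) auto
    finally show ?thesis using A(3) by simp
  qed
  have "\<exists>w. ?words w \<and> (\<forall>v. ?words v \<longrightarrow> card (act w ` cube d) \<le> card (act v ` cube d))"
    by (rule ex_has_least_nat[of ?words "[]"]) simp
  then obtain w where w: "?words w" and
    min: "\<And>v. ?words v \<Longrightarrow> card (act w ` cube d) \<le> card (act v ` cube d)"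
    by blast
  have "pairwise (\<lambda>a b. \<not> accordable \<phi> a b) (act w ` cube d)"
    unfolding pairwise_def
  proof (intro ballI impI notI)
    fix a b assume ab: "a \<in> act w ` cube d" "b \<in> act w ` cube d" "a \<noteq> b" "accordable \<phi> a b"
    then obtain v where v: "?words v" "act v a = act v b"
      unfolding accordable_def by blast
    have "\<not> inj_on (act v) (act w ` cube d)"
      using inj_onD[of "act v" "act w ` cube d" a b] ab(1-3) v(2) by argo
    then have "card (act v ` act w ` cube d) \<noteq> card (act w ` cube d)"
      using eq_card_imp_inj_on[of "act w ` cube d" "act v"] by fastforce
    moreover have "card (act v ` act w ` cube d) \<le> card (act w ` cube d)"
      by (rule card_image_le) simp
    moreover have "card (act w ` cube d) \<le> card (act v ` act w ` cube d)"
      unfolding act_append_image[symmetric] by (rule min) (use w v in simp)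
    ultimately show False by simp
  qed
  then have "card (act w ` cube d) \<in> ?sizes"
    by (intro CollectI exI[of _ "act w ` cube d"] conjI refl act_image_cube w)
  then have "card (act w ` cube d) \<le> M"
    unfolding max_nonaccordable_def by (rule Max_ge[OF fin])
  then have "sync w"
    unfolding sync_def using ge[OF w] w by (intro conjI le_antisym)
  then show "\<exists>w. sync w" ..
qed

lemma sync_words: "sync w \<Longrightarrow> set w \<subseteq> {-1, 1}"
  by (simp add: sync_def)

text \<open>
  The rank of a word is at most the rank of any of its factors, and \<open>M\<close> is the least rank.
\<close>

lemma sync_factor:
  assumes "sync w" "set u \<subseteq> {-1, 1}" "set v \<subseteq> {-1, 1}"
  shows "sync (u @ w @ v)"
proof -
  have "act (u @ w) ` cube d \<subseteq> act w ` cube d"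
    unfolding act_append_image by (intro image_mono act_image_cube assms)
  then have "card (act (u @ w) ` cube d) \<le> M"
    using assms(1) by (metis card_mono finite_cube finite_imageI sync_def)
  then have "card (act (u @ w @ v) ` cube d) \<le> M"
    using card_act_append_le[of "u @ w" v] by simp
  moreover have words: "set (u @ w @ v) \<subseteq> {-1, 1}"
    using assms by (simp add: sync_def)
  ultimately show ?thesis
    unfolding sync_def using rank_ge[OF words] by (intro conjI le_antisym)
qed

lemma sync_append: "sync w \<Longrightarrow> set v \<subseteq> {-1, 1} \<Longrightarrow> sync (w @ v)"
  using sync_factor[of w "[]" v] by simp

text \<open>
  This is what makes coupling from the past work: an earlier prefix can only shrink the image, but
  the image under a synchronizing word already has the least possible size.
\<close>

lemma sync_image_forget_past:
  assumes "sync w" "set u \<subseteq> {-1, 1}"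
  shows "act (u @ w) ` cube d = act w ` cube d"
proof (rule card_subset_eq)
  show "act (u @ w) ` cube d \<subseteq> act w ` cube d"
    unfolding act_append_image by (intro image_mono act_image_cube assms)
  show "card (act (u @ w) ` cube d) = card (act w ` cube d)"
    using sync_factor[of w u "[]"] assms by (simp add: sync_def)
qed simp

lemma sync_inj_on:
  assumes "sync w" "set v \<subseteq> {-1, 1}"
  shows "inj_on (act v) (act w ` cube d)"
proof (rule eq_card_imp_inj_on)
  show "card (act v ` act w ` cube d) = card (act w ` cube d)"
    using sync_append[OF assms] assms(1)
    unfolding sync_def act_append_image[symmetric] by argo
qed simp

section \<open>Coding tosses by twisted tosses\<close>

text \<open>
  If the last \<open>d\<close> tosses form \<open>x\<close>, then \<open>emit x w\<close> are the next tosses for which the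
  twisted tosses are \<open>w\<close>; \<open>read x\<close> is the inverse recoding.
\<close>

primrec emit :: "int list \<Rightarrow> int list \<Rightarrow> int list" where
  "emit x [] = []"
| "emit x (\<alpha> # w) = (\<alpha> * \<phi> x) # emit (shift_map \<phi> \<alpha> x) w"

primrec read :: "int list \<Rightarrow> int list \<Rightarrow> int list" where
  "read x [] = []"
| "read x (b # bs) = (\<phi> x * b) # read (tl x @ [b]) bs"

lemma tl_snoc_cube: "x \<in> cube d \<Longrightarrow> b \<in> {-1, 1} \<Longrightarrow> tl x @ [b] \<in> cube d"
  using d_pos by (cases x) (auto simp: cube_def)

lemma emit_cube: "x \<in> cube d \<Longrightarrow> w \<in> cube l \<Longrightarrow> emit x w \<in> cube l"
proof (induction w arbitrary: x l)
  case (Cons \<alpha> w)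
  then obtain m where l: "l = Suc m" "w \<in> cube m" "\<alpha> \<in> {-1, 1}"
    by (cases l) (auto simp: cube_def)
  have "emit (shift_map \<phi> \<alpha> x) w \<in> cube m"
    using Cons.IH[OF shift_map_cube] Cons.prems l by blast
  then show ?case
    using \<phi>_cases[OF Cons.prems(1)] l by (auto simp: cube_def)
qed (auto simp: cube_def)

lemma read_emit: "x \<in> cube d \<Longrightarrow> set w \<subseteq> {-1, 1} \<Longrightarrow> read x (emit x w) = w"
proof (induction w arbitrary: x)
  case (Cons \<alpha> w)
  have "read (shift_map \<phi> \<alpha> x) (emit (shift_map \<phi> \<alpha> x) w) = w"
    using Cons by (intro Cons.IH shift_map_cube) auto
  then show ?case
    using \<phi>_cases[OF Cons.prems(1)] by (auto simp: shift_map_def)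
qed auto

lemma emit_read: "x \<in> cube d \<Longrightarrow> set b \<subseteq> {-1, 1} \<Longrightarrow> emit x (read x b) = b"
proof (induction b arbitrary: x)
  case (Cons a b)
  have "\<phi> x * a * \<phi> x = a" using \<phi>_cases[OF Cons.prems(1)] by auto
  moreover have "emit (tl x @ [a]) (read (tl x @ [a]) b) = b"
    using Cons by (intro Cons.IH tl_snoc_cube) auto
  ultimately show ?case by (simp only: read.simps emit.simps shift_map_def)
qed auto

lemma act_emit: "x \<in> cube d \<Longrightarrow> set w \<subseteq> {-1, 1} \<Longrightarrow> act w x = drop (length w) (x @ emit x w)"
proof (induction w arbitrary: x)
  case (Cons \<alpha> w)
  obtain h t where x: "x = h # t" using Cons.prems d_pos by (cases x) (auto simp: cube_def)
  have "act w (shift_map \<phi> \<alpha> x) = drop (length w) (shift_map \<phi> \<alpha> x @ emit (shift_map \<phi> \<alpha> x) w)"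
    using Cons by (intro Cons.IH shift_map_cube) auto
  moreover have "shift_map \<phi> \<alpha> x = t @ [\<alpha> * \<phi> x]" by (simp add: x shift_map_def)
  ultimately show ?case by (simp add: x del: drop_append)
qed auto

lemma read_words: "x \<in> cube d \<Longrightarrow> b \<in> cube l \<Longrightarrow> read x b \<in> cube l"
proof (induction b arbitrary: x l)
  case (Cons a b)
  then obtain m where l: "l = Suc m" "b \<in> cube m" "a \<in> {-1, 1}"
    by (cases l) (auto simp: cube_def)
  have "read (tl x @ [a]) b \<in> cube m"
    using Cons.IH[OF tl_snoc_cube] Cons.prems l by blast
  then show ?case
    using \<phi>_cases[OF Cons.prems(1)] l by (auto simp: cube_def)
qed (auto simp: cube_def)

text \<open>
  Whatever the current state is, the next \<open>d\<close> tosses can be prescribed, and they form the next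
  state.
\<close>

lemma act_transitive:
  assumes "x \<in> cube d" "y \<in> cube d"
  obtains w where "set w \<subseteq> {-1, 1}" "act w x = y"
proof
  have y: "set y \<subseteq> {-1, 1}" using assms by (simp add: cube_def)
  have r: "read x y \<in> cube d" using read_words assms by blast
  then show *: "set (read x y) \<subseteq> {-1, 1}" by (simp add: cube_def)
  show "act (read x y) x = y"
    using act_emit[OF assms(1) *] emit_read[OF assms(1) y] r assms by (simp add: cube_def)
qed

section \<open>The fibres of a synchronizing word\<close>

definition act_vimage :: "int list \<Rightarrow> int list set \<Rightarrow> int list set" where
  "act_vimage w S = {x \<in> cube d. act w x \<in> S}"

lemma act_vimage_append: "set u \<subseteq> {-1, 1} \<Longrightarrow> act_vimage (u @ v) S = act_vimage u (act_vimage v S)"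
  by (auto simp: act_vimage_def act_cube)

lemma finite_act_vimage [simp]: "finite (act_vimage w S)"
  by (simp add: act_vimage_def)

text \<open>
  The uniform law on the cube is invariant: a point \<open>y\<close> has exactly two pairs of a letter and a
  predecessor that lead to it, since the predecessor is \<open>y\<close> without its last coordinate, preceded
  by an arbitrary sign, and then the letter is determined.
\<close>

lemma card_act_vimage_letters:
  assumes S: "S \<subseteq> cube d"
  shows "card (act_vimage [1] S) + card (act_vimage [-1] S) = 2 * card S"
proof -
  let ?D = "SIGMA \<alpha> : {-1, 1}. act_vimage [\<alpha>] S"
  have "bij_betw (\<lambda>(\<alpha>, x). (shift_map \<phi> \<alpha> x, hd x)) ?D (S \<times> {-1, 1})"
  proof (rule bij_betw_byWitness[where f' = "\<lambda>(y, h). (last y * \<phi> (h # butlast y), h # butlast y)"])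
    have cons: "hd x # tl x = x" if "x \<in> cube d" for x
      using that d_pos by (cases x) (auto simp: cube_def)
    have sq: "\<alpha> * \<phi> x * \<phi> x = \<alpha>" if "x \<in> cube d" for \<alpha> x
      using \<phi>_cases[OF that] by auto
    show "\<forall>p\<in>?D. (case case p of (\<alpha>, x) \<Rightarrow> (shift_map \<phi> \<alpha> x, hd x) of
        (y, h) \<Rightarrow> (last y * \<phi> (h # butlast y), h # butlast y)) = p"
    proof
      fix p assume "p \<in> ?D"
      then obtain \<alpha> x where p: "p = (\<alpha>, x)" and x: "x \<in> cube d"
        by (auto simp: act_vimage_def)
      show "(case case p of (\<alpha>, x) \<Rightarrow> (shift_map \<phi> \<alpha> x, hd x) of
        (y, h) \<Rightarrow> (last y * \<phi> (h # butlast y), h # butlast y)) = p"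
        using cons[OF x] sq[OF x, of \<alpha>] by (simp add: p shift_map_def)
    qed
    have hb: "h # butlast y \<in> cube d" if "y \<in> cube d" "h \<in> {-1, 1}" for y h
      using that d_pos by (auto simp: cube_def dest: in_set_butlastD)
    have sm: "shift_map \<phi> (last y * \<phi> (h # butlast y)) (h # butlast y) = y"
      if "y \<in> cube d" "h \<in> {-1, 1}" for y h
    proof -
      have "y \<noteq> []" using that d_pos by (auto simp: cube_def)
      then show ?thesis
        unfolding shift_map_def by (simp only: sq[OF hb[OF that]] list.sel) simp
    qed
    show "\<forall>q\<in>S \<times> {-1, 1}. (case case q of (y, h) \<Rightarrow> (last y * \<phi> (h # butlast y), h # butlast y) of
        (\<alpha>, x) \<Rightarrow> (shift_map \<phi> \<alpha> x, hd x)) = q"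
      using sm S by auto
    have hd: "hd x \<in> {-1, 1}" if "x \<in> cube d" for x
      using that d_pos by (cases x) (auto simp: cube_def)
    show "(\<lambda>(\<alpha>, x). (shift_map \<phi> \<alpha> x, hd x)) ` ?D \<subseteq> S \<times> {-1, 1}"
      using hd by (auto simp: act_vimage_def)
    have lt: "last y * \<phi> x \<in> {-1, 1}" if "y \<in> cube d" "x \<in> cube d" for x y
    proof -
      have "y \<noteq> []" "set y \<subseteq> {-1, 1}" using that d_pos by (auto simp: cube_def)
      then have "last y \<in> {-1, 1}" using last_in_set by blast
      then show ?thesis using \<phi>_cases[OF that(2)] by auto
    qed
    show "(\<lambda>(y, h). (last y * \<phi> (h # butlast y), h # butlast y)) ` (S \<times> {-1, 1}) \<subseteq> ?D"
    proof (rule image_subsetI)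
      fix q assume "q \<in> S \<times> {-1, 1 :: int}"
      then obtain y h where q: "q = (y, h)" "y \<in> S" "h \<in> {-1, 1}"
        by blast
      then have y: "y \<in> cube d" using S by blast
      show "(case q of (y, h) \<Rightarrow> (last y * \<phi> (h # butlast y), h # butlast y)) \<in> ?D"
        using q lt[OF y hb[OF y q(3)]] hb[OF y q(3)] sm[OF y q(3)] by (simp add: act_vimage_def)
    qed
  qed
  then have "card ?D = card (S \<times> {-1, 1 :: int})" by (rule bij_betw_same_card)
  moreover have "card ?D = card (act_vimage [-1] S) + card (act_vimage [1] S)"
    by (subst card_SigmaI) auto
  moreover have "card (S \<times> {-1, 1 :: int}) = 2 * card S"
    by (simp add: card_cartesian_product)
  ultimately show ?thesis by simp
qed

definition collapsible :: "int list set \<Rightarrow> bool" where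
  "collapsible S \<longleftrightarrow> S \<subseteq> cube d \<and> (\<exists>v y. set v \<subseteq> {-1, 1} \<and> (\<forall>x\<in>S. act v x = y))"

lemma collapsible_act_vimage: "collapsible S \<Longrightarrow> set w \<subseteq> {-1, 1} \<Longrightarrow> collapsible (act_vimage w S)"
proof -
  assume "collapsible S" and w: "set w \<subseteq> {-1, 1}"
  then obtain v y where "set v \<subseteq> {-1, 1}" "\<forall>x\<in>S. act v x = y"
    by (auto simp: collapsible_def)
  then have "set (w @ v) \<subseteq> {-1, 1}" "\<forall>x\<in>act_vimage w S. act (w @ v) x = y"
    using w by (auto simp: act_vimage_def)
  then show "collapsible (act_vimage w S)"
    unfolding collapsible_def
    by (intro conjI exI[of _ "w @ v"] exI[of _ y]) (auto simp: act_vimage_def)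
qed

text \<open>
  Let \<open>S\<close> be a largest set that some word collapses to a point. Its preimages under the two letters
  are collapsible and have \<open>2 * card S\<close> points in total, so both are again largest; hence so are
  its preimages under all words. A collapsible set meets the image of a synchronizing word \<open>v\<close> in at
  most one point, because every word is injective on that image. So the preimage under \<open>v\<close> of a
  largest collapsible set through \<open>z\<close> is just the fibre of \<open>z\<close>, which therefore has \<open>card S\<close>
  points. By transitivity every \<open>z\<close> lies in a largest collapsible set; thus all \<open>M\<close> fibres have
  the same size.
\<close>

theorem card_sync_class:
  assumes v: "sync v" and z: "z \<in> act v ` cube d"
  shows "M * card {x \<in> cube d. act v x = z} = 2 ^ d"
proof -
  have vw: "set v \<subseteq> {-1, 1}" by (rule sync_words[OF v])
  have x0: "replicate d 1 \<in> cube d" by (auto simp: cube_def)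
  then have "collapsible {replicate d 1}"
    by (auto simp: collapsible_def intro!: exI[of _ "[]"])
  moreover have bnd: "card S \<le> 2 ^ d" if "collapsible S" for S
    using card_mono[of "cube d" S] that by (auto simp: collapsible_def)
  ultimately obtain S where S: "collapsible S" and max: "\<And>T. collapsible T \<Longrightarrow> card T \<le> card S"
    using ex_has_greatest_nat[of collapsible "{replicate d 1}" card "Suc (2 ^ d)"]
    by (auto simp: less_Suc_eq_le)
  have card_S: "card S > 0"
    using max[OF \<open>collapsible {replicate d 1}\<close>] by simp
  have max_pre: "collapsible (act_vimage w S) \<and> card (act_vimage w S) = card S" if "set w \<subseteq> {-1, 1}" for w
    using that
  proof (induction w)
    case Nil
    have "act_vimage [] S = S" using S by (auto simp: act_vimage_def collapsible_def)
    with S show ?case by simp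
  next
    case (Cons \<alpha> w)
    let ?T = "act_vimage w S"
    have T: "collapsible ?T" "card ?T = card S" using Cons by auto
    have "card (act_vimage [1] ?T) \<le> card S" "card (act_vimage [-1] ?T) \<le> card S"
      by (intro max collapsible_act_vimage T; simp)+
    moreover have "card (act_vimage [1] ?T) + card (act_vimage [-1] ?T) = 2 * card S"
      using card_act_vimage_letters[of ?T] T by (simp add: act_vimage_def)
    ultimately have "card (act_vimage [\<alpha>] ?T) = card S"
      using Cons.prems by auto
    then show ?case
      using act_vimage_append[of "[\<alpha>]" w S] collapsible_act_vimage[OF T(1), of "[\<alpha>]"] Cons.prems by simp
  qed
  have fibre: "card {x \<in> cube d. act v x = z} = card S" if z: "z \<in> act v ` cube d" for z
  proof -
    obtain s where s: "s \<in> S" using card_S by (metis card.empty ex_in_conv less_irrefl)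
    have zc: "z \<in> cube d" using act_image_cube[OF vw] z by blast
    moreover have "s \<in> cube d" using s S by (auto simp: collapsible_def)
    ultimately obtain t where t: "set t \<subseteq> {-1, 1}" "act t z = s"
      by (rule act_transitive)
    \<comment> \<open>A collapsible set of the largest size that contains \<open>z\<close>.\<close>
    let ?S = "act_vimage t S"
    have zS: "z \<in> ?S" using t s zc by (simp add: act_vimage_def)
    have "collapsible ?S" using max_pre[OF t(1)] by simp
    then obtain u y where u: "set u \<subseteq> {-1, 1}" "\<forall>x\<in>?S. act u x = y"
      by (auto simp: collapsible_def)
    have only: "x = z" if "x \<in> ?S" "x \<in> act v ` cube d" for x
    proof (rule inj_onD[OF sync_inj_on[OF v u(1)] _ that(2) z])
      show "act u x = act u z" using u(2) that(1) zS by metis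
    qed
    have "act_vimage v ?S = {x \<in> cube d. act v x = z}"
      unfolding act_vimage_def[of v]
    proof (intro Collect_cong conj_cong refl iffI)
      fix x assume "x \<in> cube d" "act v x \<in> ?S"
      then show "act v x = z" by (intro only imageI)
    qed (use zS in simp)
    moreover have "card (act_vimage v ?S) = card S"
      using max_pre[of "v @ t"] vw t by (simp add: act_vimage_append)
    ultimately show ?thesis by simp
  qed
  have "(2::nat) ^ d = card (\<Union>z\<in>act v ` cube d. {x \<in> cube d. act v x = z})"
    by (subst card_cube[symmetric], rule arg_cong[where f = card]) auto
  also have "\<dots> = (\<Sum>z\<in>act v ` cube d. card {x \<in> cube d. act v x = z})"
    by (rule card_UN_disjoint) auto
  also have "\<dots> = M * card S"
    using v fibre by (simp add: sync_def)
  finally show ?thesis using fibre[OF z] by simp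
qed

lemma M_pos: "M > 0"
proof -
  obtain w where w: "sync w" using ex_sync by blast
  have "replicate d 1 \<in> cube d" by (auto simp: cube_def)
  then have "0 < card (act w ` cube d)" by (auto simp: card_gt_0_iff)
  then show ?thesis using w unfolding sync_def by argo
qed

lemma card_sync_number:
  assumes v: "sync v" and num: "bij_betw f (act v ` cube d) {1..M}"
  shows "M * card {x \<in> cube d. f (act v x) \<in> B} = card (B \<inter> {1..M}) * 2 ^ d"
proof -
  let ?Z = "{z \<in> act v ` cube d. f z \<in> B}"
  have fin: "finite ?Z" by simp
  have "card {x \<in> cube d. f (act v x) \<in> B} = card (\<Union>z\<in>?Z. {x \<in> cube d. act v x = z})"
    by (rule arg_cong[where f = card]) auto
  also have "\<dots> = (\<Sum>z\<in>?Z. card {x \<in> cube d. act v x = z})"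
    by (rule card_UN_disjoint) auto
  finally have "M * card {x \<in> cube d. f (act v x) \<in> B} = (\<Sum>z\<in>?Z. M * card {x \<in> cube d. act v x = z})"
    by (simp add: sum_distrib_left)
  also have "\<dots> = card ?Z * 2 ^ d"
    using card_sync_class[OF v] by simp
  also have "card ?Z = card (B \<inter> {1..M})"
  proof (rule bij_betw_same_card[of f])
    show "bij_betw f ?Z (B \<inter> {1..M})"
      unfolding bij_betw_def
    proof
      show "inj_on f ?Z"
        using num by (auto simp: bij_betw_def intro: inj_on_subset)
      have "f ` ?Z = B \<inter> f ` (act v ` cube d)" by blast
      then show "f ` ?Z = B \<inter> {1..M}"
        using num by (simp add: bij_betw_def)
    qed
  qed
  finally show ?thesis .
qed

section \<open>Images of synchronizing words are recurrent\<close>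

text \<open>
  Along the word, the set-valued chain started at \<open>B\<close> does not visit \<open>A\<close>; as for first passage
  times, time 0 does not count.
\<close>

primrec avoids :: "int list set \<Rightarrow> int list set \<Rightarrow> int list \<Rightarrow> bool" where
  "avoids A B [] = True"
| "avoids A B (\<alpha> # w) = (shift_map \<phi> \<alpha> ` B \<noteq> A \<and> avoids A (shift_map \<phi> \<alpha> ` B) w)"

lemma avoids_prefix: "avoids A B (u @ v) \<Longrightarrow> avoids A B u"
  by (induction u arbitrary: B) auto

lemma avoids_end: "w \<noteq> [] \<Longrightarrow> avoids A B w \<Longrightarrow> act w ` B \<noteq> A"
proof (induction w arbitrary: B)
  case (Cons \<alpha> w)
  then show ?case by (cases "w = []") (auto simp: image_image)
qed auto

lemma expectation_set_kernel:
  "measure_pmf.expectation (set_kernel \<phi> A) g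
    = (g (shift_map \<phi> 1 ` A) + g (shift_map \<phi> (-1) ` A)) / 2" for g :: "int list set \<Rightarrow> real"
  unfolding set_kernel_def by (simp add: integral_pmf_of_set)

lemma pmf_set_kernel:
  "pmf (set_kernel \<phi> A) B
    = (of_bool (shift_map \<phi> 1 ` A = B) + of_bool (shift_map \<phi> (-1) ` A = B)) / 2"
proof -
  have "pmf (set_kernel \<phi> A) B = measure_pmf.expectation (set_kernel \<phi> A) (indicator {B})"
    by (simp add: pmf.rep_eq)
  then show ?thesis
    unfolding expectation_set_kernel by (simp add: indicator_def of_bool_def)
qed

lemma card_cube_Suc:
  "card {w \<in> cube (Suc n). P w} = card {w \<in> cube n. P (1 # w)} + card {w \<in> cube n. P (-1 # w)}"
proof -
  have "{w \<in> cube (Suc n). P w} = (#) 1 ` {w \<in> cube n. P (1 # w)} \<union> (#) (-1) ` {w \<in> cube n. P (-1 # w)}"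
    by (auto simp: cube_def length_Suc_conv)
  moreover have "card (\<dots>) = card ((#) 1 ` {w \<in> cube n. P (1 # w)}) + card ((#) (-1) ` {w \<in> cube n. P (-1 # w)})"
    by (rule card_Un_disjoint) auto
  ultimately show ?thesis
    by (simp add: card_image)
qed

text \<open>
  Both sides are the probability that the chain started at \<open>B\<close> visits \<open>A\<close> during the first
  \<open>n\<close> steps; conditioning on the first step gives the same recursion for both.
\<close>

lemma sum_first_passage:
  "(\<Sum>k<n. first_passage (set_kernel \<phi>) A k B) = 1 - real (card {w \<in> cube n. avoids A B w}) / 2 ^ n"
proof (induction n arbitrary: B)
  case 0
  have "{w. w = [] \<and> avoids A B w} = {[]}" by auto
  then show ?case by simp
next
  case (Suc n)
  let ?f = "first_passage (set_kernel \<phi>) A" and ?c = "\<lambda>n B. real (card {w \<in> cube n. avoids A B w})"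
  have "(\<Sum>k<Suc n. ?f k B) = ?f 0 B + (\<Sum>k<n. ?f (Suc k) B)"
    by (rule sum.lessThan_Suc_shift)
  also have "(\<Sum>k<n. ?f (Suc k) B) = (\<Sum>\<alpha>\<in>{1,-1}. if shift_map \<phi> \<alpha> ` B = A then 0
      else (\<Sum>k<n. ?f k (shift_map \<phi> \<alpha> ` B))) / 2"
    by (simp add: expectation_set_kernel sum_divide_distrib[symmetric] sum.distrib)
  also have "?f 0 B + \<dots> = 1 - (\<Sum>\<alpha>\<in>{1,-1}. if shift_map \<phi> \<alpha> ` B = A then 0 
      else ?c n (shift_map \<phi> \<alpha> ` B)) / 2 ^ Suc n"
    unfolding Suc.IH by (auto simp: pmf_set_kernel field_simps)
  also have "(\<Sum>\<alpha>\<in>{1,-1}. if shift_map \<phi> \<alpha> ` B = A then 0 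
      else ?c n (shift_map \<phi> \<alpha> ` B)) = ?c (Suc n) B"
    by (auto simp: card_cube_Suc)
  finally show ?case .
qed

text \<open>
  Every state reached from \<open>act u ` cube d\<close> is an image of the cube, and \<open>u\<close> sends any image of the
  cube back to \<open>act u ` cube d\<close>. So reading \<open>u\<close> completes a return, and the words whose paths
  do not return form a language that avoids a factor.
\<close>

theorem sync_image_recurrent:
  assumes u: "sync u"
  shows "act u ` cube d \<in> recurrent_class d \<phi>"
proof -
  let ?A = "act u ` cube d"
  have uw: "set u \<subseteq> {-1, 1}" by (rule sync_words[OF u])
  let ?S = "{w. set w \<subseteq> {-1, 1} \<and> avoids ?A ?A w}"
  have "(\<lambda>n. real (card (?S \<inter> cube n)) / 2 ^ n) \<longlonglongrightarrow> 0"
    \<comment> \<open>The extra letter makes the forbidden factor nonempty even if \<open>u\<close> is empty.\<close>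
  proof (rule density_avoiding_factor[where w = "1 # u"])
    show "s @ (1 # u) @ t \<notin> ?S" for s t
    proof
      assume S: "s @ (1 # u) @ t \<in> ?S"
      then have "avoids ?A ?A (s @ 1 # u)"
        using avoids_prefix[of ?A ?A "s @ 1 # u" t] by simp
      then have "act (s @ 1 # u) ` ?A \<noteq> ?A" by (rule avoids_end[rotated]) simp
      moreover have "act ((u @ s @ [1]) @ u) ` cube d = ?A"
        using S uw by (intro sync_image_forget_past u) auto
      ultimately show False by (simp add: image_image)
    qed
  qed (use uw avoids_prefix in auto)
  moreover have "?S \<inter> cube n = {w \<in> cube n. avoids ?A ?A w}" for n
    by (auto simp: cube_def)
  ultimately have "(\<lambda>n. 1 - real (card {w \<in> cube n. avoids ?A ?A w}) / 2 ^ n) \<longlonglongrightarrow> 1 - 0"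
    by (intro tendsto_diff tendsto_const) simp
  then have "recurrent (set_kernel \<phi>) ?A"
    by (simp add: recurrent_def sums_def sum_first_passage)
  then show ?thesis
    using act_image_cube[OF uw] u by (simp add: recurrent_class_def sync_def)
qed

lemma density_not_sync: "(\<lambda>n. real (card {w \<in> cube n. \<not> sync w}) / 2 ^ n) \<longlonglongrightarrow> 0"
proof -
  obtain u where u: "sync u" using ex_sync by blast
  let ?S = "{w. set w \<subseteq> {-1, 1} \<and> \<not> sync w}"
  have "(\<lambda>n. real (card (?S \<inter> cube n)) / 2 ^ n) \<longlonglongrightarrow> 0"
  proof (rule density_avoiding_factor[where w = "1 # u"])
    show "s @ (1 # u) @ t \<notin> ?S" for s t
      using sync_factor[OF u, of "s @ [1]" t] by auto
  qed (use sync_words[OF u] sync_append in auto)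
  moreover have "?S \<inter> cube n = {w \<in> cube n. \<not> sync w}" for n
    by (auto simp: cube_def)
  ultimately show ?thesis by simp
qed

end

section \<open>Windows of a process and coin tossing\<close>

lemma length_window [simp]: "length (window l \<xi> n \<omega>) = l"
  by (simp add: window_def)

lemma window_0 [simp]: "window 0 \<xi> n \<omega> = []"
  by (simp add: window_def)

lemma window_Suc: "window (Suc l) \<xi> n \<omega> = window l \<xi> (n - 1) \<omega> @ [\<xi> n \<omega>]"
  using upto_rec2[of "n - int (Suc l) + 1" n] by (simp add: window_def)

lemma window_1 [simp]: "window (Suc 0) \<xi> n \<omega> = [\<xi> n \<omega>]"
  by (simp add: window_Suc)

lemma window_Cons: "window (Suc l) \<xi> (n + int (Suc l)) \<omega> = \<xi> (n + 1) \<omega> # window l \<xi> (n + 1 + int l) \<omega>"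
  using upto_rec1[of "n + 1" "n + int (Suc l)"] by (simp add: window_def add_ac)

lemma window_append: "window (k + l) \<xi> n \<omega> = window k \<xi> (n - int l) \<omega> @ window l \<xi> n \<omega>"
  by (induction l arbitrary: n) (simp_all add: window_Suc algebra_simps)

lemma window_nth: "i < l \<Longrightarrow> window l \<xi> n \<omega> ! i = \<xi> (n - int l + 1 + int i) \<omega>"
  by (simp add: window_def)

lemma window_nth_between:
  "m \<le> j \<Longrightarrow> j \<le> n \<Longrightarrow> window (nat (n - m + 1)) \<xi> n \<omega> ! nat (j - m) = \<xi> j \<omega>"
  by (subst window_nth) auto

lemma window_cong: "(\<And>k. k \<le> n \<Longrightarrow> \<xi> k \<omega> = \<zeta> k \<omega>') \<Longrightarrow> window l \<xi> n \<omega> = window l \<zeta> n \<omega>'"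
  by (auto simp: window_def)

lemma measurable_window:
  assumes "\<And>k. k \<le> n \<Longrightarrow> \<xi> k \<in> N \<rightarrow>\<^sub>M count_space UNIV"
  shows "window l \<xi> n \<in> N \<rightarrow>\<^sub>M count_space UNIV"
  using assms
proof (induction l arbitrary: n)
  case 0
  have "window 0 \<xi> n = (\<lambda>\<omega>. [])" by (simp add: fun_eq_iff)
  then show ?case by simp
next
  case (Suc l)
  have eq: "window (Suc l) \<xi> n = (\<lambda>\<omega>. window l \<xi> (n - 1) \<omega> @ [\<xi> n \<omega>])"
    by (simp add: fun_eq_iff window_Suc)
  show ?case unfolding eq
  proof (rule measurable_compose_countable[where f = "\<lambda>u \<omega>. u @ [\<xi> n \<omega>]"])
    show "(\<lambda>\<omega>. u @ [\<xi> n \<omega>]) \<in> N \<rightarrow>\<^sub>M count_space UNIV" for u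
      using measurable_compose[OF Suc.prems[of n], of "\<lambda>a. u @ [a]" "count_space UNIV"] by simp
    show "window l \<xi> (n - 1) \<in> N \<rightarrow>\<^sub>M count_space UNIV"
      using Suc.prems by (intro Suc.IH) simp
  qed
qed

lemma sets_window_event:
  assumes "\<And>k. k \<le> n \<Longrightarrow> \<xi> k \<in> N \<rightarrow>\<^sub>M count_space UNIV"
  shows "{\<omega> \<in> space N. Q (window l \<xi> n \<omega>)} \<in> sets N"
proof -
  have "window l \<xi> n -` {w. Q w} \<inter> space N \<in> sets N"
    using measurable_window[OF assms, where l = l] by (rule measurable_sets) simp_all
  moreover have "window l \<xi> n -` {w. Q w} \<inter> space N = {\<omega> \<in> space N. Q (window l \<xi> n \<omega>)}"
    by auto
  ultimately show ?thesis by simp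
qed

lemma measurable_signs_UNIV:
  "\<xi> \<in> N \<rightarrow>\<^sub>M count_space S \<Longrightarrow> \<xi> \<in> N \<rightarrow>\<^sub>M count_space UNIV"
  using measurable_compose[of \<xi> N "count_space S" "\<lambda>x. x" "count_space UNIV"] by simp

lemma window_in_cube:
  assumes "\<And>k. \<xi> k \<in> N \<rightarrow>\<^sub>M count_space {-1, 1}" "\<omega> \<in> space N"
  shows "window l \<xi> n \<omega> \<in> cube l"
  using measurable_space[OF assms(1,2)] by (auto simp: cube_def window_def)

lemma (in finite_measure) measure_equal_atoms:
  assumes Y: "Y \<in> M \<rightarrow>\<^sub>M count_space UNIV" "Y \<in> space M \<rightarrow> C"
    and C: "finite C" "\<And>y. y \<in> C \<Longrightarrow> measure M {\<omega> \<in> space M. Y \<omega> = y} = c"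
  shows "measure M {\<omega> \<in> space M. Y \<omega> \<in> S} = real (card (S \<inter> C)) * c"
proof -
  have "{\<omega> \<in> space M. Y \<omega> \<in> S} = (\<Union>y\<in>S \<inter> C. {\<omega> \<in> space M. Y \<omega> = y})"
    using Y(2) by auto
  also have "measure M \<dots> = (\<Sum>y\<in>S \<inter> C. measure M {\<omega> \<in> space M. Y \<omega> = y})"
  proof (rule finite_measure_finite_Union)
    have "{\<omega> \<in> space M. Y \<omega> = y} \<in> sets M" for y
      using measurable_sets[OF Y(1), of "{y}"] by (simp add: vimage_def Int_def conj_commute)
    then show "(\<lambda>y. {\<omega> \<in> space M. Y \<omega> = y}) ` (S \<inter> C) \<subseteq> sets M" by blast
  qed (use C in \<open>auto simp: disjoint_family_on_def\<close>)
  also have "\<dots> = real (card (S \<inter> C)) * c" using C by simp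
  finally show ?thesis .
qed

lemma coin_tossing_measurable: "coin_tossing P \<xi> \<Longrightarrow> \<xi> k \<in> P \<rightarrow>\<^sub>M count_space {-1, 1}"
  unfolding coin_tossing_def by (auto simp: prob_space.indep_vars_def2)

lemma coin_tossing_prob_space: "coin_tossing P \<xi> \<Longrightarrow> prob_space P"
  by (simp add: coin_tossing_def)

lemma coin_tossing_prob_eq:
  assumes "coin_tossing P \<xi>" "a \<in> {-1, 1}"
  shows "measure P (\<xi> k -` {a} \<inter> space P) = 1 / 2"
proof -
  have "measure P (\<xi> k -` {a} \<inter> space P) = measure (distr P (count_space UNIV) (\<xi> k)) {a}"
    using measurable_signs_UNIV[OF coin_tossing_measurable[OF assms(1)]]
    by (subst measure_distr) auto
  also have "\<dots> = pmf (pmf_of_set {-1, 1}) a"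
    using assms(1) by (simp add: coin_tossing_def pmf.rep_eq)
  finally show ?thesis using assms(2) by auto
qed

lemma coin_tossing_window:
  assumes c: "coin_tossing P \<xi>" and w: "w \<in> cube l"
  shows "measure P {\<omega> \<in> space P. window l \<xi> n \<omega> = w} = 1 / 2 ^ l"
proof -
  interpret prob_space P by (rule coin_tossing_prob_space[OF c])
  have lw: "length w = l" using w by (simp add: cube_def)
  show ?thesis
  proof (cases "l = 0")
    case True
    then have "{\<omega> \<in> space P. window l \<xi> n \<omega> = w} = space P"
      using lw by simp
    then show ?thesis using True prob_space by simp
  next
    case False
    let ?a = "\<lambda>i. n - int l + 1 + int i" and ?J = "(\<lambda>i. n - int l + 1 + int i) ` {..<l}"
    let ?A = "\<lambda>k. {w ! nat (k - (n - int l + 1))}"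
    have letter: "w ! nat (k - (n - int l + 1)) \<in> {-1, 1}" if "k \<in> ?J" for k
    proof -
      have "nat (k - (n - int l + 1)) < length w" using that lw by auto
      then have "w ! nat (k - (n - int l + 1)) \<in> set w" by (rule nth_mem)
      moreover have "set w \<subseteq> {-1, 1}" using w by (simp add: cube_def)
      ultimately show ?thesis by (rule rev_subsetD)
    qed
    have inj: "inj_on ?a {..<l}" by (auto simp: inj_on_def)
    have "(window l \<xi> n \<omega> = w) \<longleftrightarrow> (\<forall>i<l. \<xi> (?a i) \<omega> = w ! i)" for \<omega>
      using lw by (auto simp: list_eq_iff_nth_eq window_nth)
    then have event: "{\<omega> \<in> space P. window l \<xi> n \<omega> = w} = (\<Inter>k\<in>?J. \<xi> k -` ?A k \<inter> space P)"
      using False by auto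
    have "prob (\<Inter>k\<in>?J. \<xi> k -` ?A k \<inter> space P) = (\<Prod>k\<in>?J. prob (\<xi> k -` ?A k \<inter> space P))"
    proof (rule indep_varsD[where M' = "\<lambda>_. count_space {-1, 1}" and I = UNIV and A = ?A])
      show "indep_vars (\<lambda>_. count_space {-1, 1}) \<xi> UNIV"
        using c unfolding coin_tossing_def by (elim conjE)
      show "?J \<noteq> {}" "finite ?J" "?J \<subseteq> UNIV" using False by auto
      show "?A k \<in> sets (count_space {-1, 1})" if "k \<in> ?J" for k
        using letter[OF that] by (simp only: sets_count_space Pow_iff insert_subset empty_subsetI simp_thms)
    qed
    also have "\<dots> = (\<Prod>k\<in>?J. 1 / 2)"
    proof (rule prod.cong)
      fix k assume "k \<in> ?J"
      then show "prob (\<xi> k -` ?A k \<inter> space P) = 1 / 2"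
        by (rule coin_tossing_prob_eq[OF c letter])
    qed (rule refl)
    also have "\<dots> = 1 / 2 ^ l"
      by (simp add: card_image[OF inj] power_one_over)
    finally show ?thesis unfolding event .
  qed
qed

text \<open>
  A sequence of signs is coin-tossing as soon as its finite blocks are uniform. The product formula
  need not be computed: any finite set of times lies in one window, so probabilities of such events
  can be copied from a sequence \<open>\<epsilon>\<close> that is known to be coin-tossing.
\<close>

lemma coin_tossing_transfer:
  assumes c: "coin_tossing P \<epsilon>" and Q: "prob_space Q"
    and m: "\<And>k. \<eta> k \<in> Q \<rightarrow>\<^sub>M count_space {-1, 1}"
    and law: "\<And>l n w. w \<in> cube l \<Longrightarrow> measure Q {\<omega> \<in> space Q. window l \<eta> n \<omega> = w} = 1 / 2 ^ l"
  shows "coin_tossing Q \<eta>"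
proof -
  interpret P: prob_space P by (rule coin_tossing_prob_space[OF c])
  interpret Q: prob_space Q by (rule Q)
  note mP = coin_tossing_measurable[OF c]
  have law_eq: "measure Q {\<omega> \<in> space Q. window l \<eta> n \<omega> \<in> S} = measure P {\<omega> \<in> space P. window l \<epsilon> n \<omega> \<in> S}" for l n S
  proof -
    have "measure Q {\<omega> \<in> space Q. window l \<eta> n \<omega> \<in> S} = card (S \<inter> cube l) * (1 / 2 ^ l)"
      by (rule Q.measure_equal_atoms)
        (use m law in \<open>auto intro!: measurable_window measurable_signs_UNIV[OF m] window_in_cube\<close>)
    moreover have "measure P {\<omega> \<in> space P. window l \<epsilon> n \<omega> \<in> S} = card (S \<inter> cube l) * (1 / 2 ^ l)"
      by (rule P.measure_equal_atoms)
        (use mP coin_tossing_window[OF c] in \<open>auto intro!: measurable_window measurable_signs_UNIV[OF mP] window_in_cube\<close>)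
    ultimately show ?thesis by simp
  qed
  have one: "measure Q (\<eta> k -` B \<inter> space Q) = measure P (\<epsilon> k -` B \<inter> space P)" for k B
  proof -
    have "\<eta> k -` B \<inter> space Q = {\<omega> \<in> space Q. window 1 \<eta> k \<omega> \<in> {w. hd w \<in> B}}"
      "\<epsilon> k -` B \<inter> space P = {\<omega> \<in> space P. window 1 \<epsilon> k \<omega> \<in> {w. hd w \<in> B}}"
      by auto
    then show ?thesis using law_eq[of 1] by presburger
  qed
  have indep: "measure Q (\<Inter>j\<in>J. \<eta> j -` B j \<inter> space Q) = (\<Prod>j\<in>J. measure Q (\<eta> j -` B j \<inter> space Q))"
    if J: "J \<noteq> {}" "finite J" and B: "\<And>j. j \<in> J \<Longrightarrow> B j \<subseteq> {-1, 1}" for J B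
  proof -
    let ?n = "Max J" and ?m = "Min J"
    define l where "l = nat (?n - ?m + 1)"
    let ?S = "{w. \<forall>j\<in>J. w ! nat (j - ?m) \<in> B j}"
    have nth: "window l \<eta> ?n \<omega> ! nat (j - ?m) = \<eta> j \<omega>" "window l \<epsilon> ?n \<omega>' ! nat (j - ?m) = \<epsilon> j \<omega>'"
      if "j \<in> J" for j \<omega> \<omega>'
      using J that unfolding l_def by (intro window_nth_between; simp)+
    have eventQ: "(\<Inter>j\<in>J. \<eta> j -` B j \<inter> space Q) = {\<omega> \<in> space Q. window l \<eta> ?n \<omega> \<in> ?S}"
      using J nth by auto
    have eventP: "(\<Inter>j\<in>J. \<epsilon> j -` B j \<inter> space P) = {\<omega> \<in> space P. window l \<epsilon> ?n \<omega> \<in> ?S}"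
      using J nth by auto
    have "measure P (\<Inter>j\<in>J. \<epsilon> j -` B j \<inter> space P) = (\<Prod>j\<in>J. measure P (\<epsilon> j -` B j \<inter> space P))"
    proof (rule P.indep_varsD[where M' = "\<lambda>_. count_space {-1, 1}" and I = UNIV and A = B])
      show "P.indep_vars (\<lambda>_. count_space {-1, 1}) \<epsilon> UNIV"
        using c by (simp add: coin_tossing_def)
    qed (use J B in auto)
    then show ?thesis unfolding eventQ law_eq eventP by (simp add: one)
  qed
  have "Q.indep_vars (\<lambda>_. count_space {-1, 1}) \<eta> UNIV"
    unfolding Q.indep_vars_def2
  proof (intro conjI ballI m Q.indep_setsI)
    fix i
    show "{\<eta> i -` A \<inter> space Q |A. A \<in> sets (count_space {-1, 1})} \<subseteq> Q.events"
      using measurable_sets[OF m] by blast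
  next
    fix A J assume J: "J \<noteq> {}" "finite J"
      and A: "\<forall>j\<in>J. A j \<in> {\<eta> j -` A \<inter> space Q |A. A \<in> sets (count_space {-1, 1})}"
    then have "\<forall>j\<in>J. \<exists>B. A j = \<eta> j -` B \<inter> space Q \<and> B \<subseteq> {-1, 1}" by auto
    then obtain B where B: "\<And>j. j \<in> J \<Longrightarrow> A j = \<eta> j -` B j \<inter> space Q"
      "\<And>j. j \<in> J \<Longrightarrow> B j \<subseteq> {-1, 1}"
      by metis
    show "Q.prob (\<Inter>j\<in>J. A j) = (\<Prod>j\<in>J. Q.prob (A j))"
      using indep[OF J B(2)] B(1) by simp
  qed
  moreover have "distr Q (count_space UNIV) (\<eta> n) = measure_pmf (pmf_of_set {-1, 1})" for n
  proof -
    have "distr Q (count_space UNIV) (\<eta> n) = distr P (count_space UNIV) (\<epsilon> n)"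
    proof (rule measure_eqI)
      fix A
      show "emeasure (distr Q (count_space UNIV) (\<eta> n)) A = emeasure (distr P (count_space UNIV) (\<epsilon> n)) A"
        using measurable_signs_UNIV[OF m] measurable_signs_UNIV[OF mP]
        by (simp add: emeasure_distr Q.emeasure_eq_measure P.emeasure_eq_measure one)
    qed simp
    then show ?thesis using c by (simp add: coin_tossing_def)
  qed
  ultimately show ?thesis by (simp add: coin_tossing_def Q)
qed

section \<open>The twisted sequence drives the windows\<close>

locale coin_driven_automaton = cube_automaton +
  fixes P :: "'a measure" and \<epsilon> :: "int \<Rightarrow> 'a \<Rightarrow> int"
  assumes coin: "coin_tossing P \<epsilon>"
begin

abbreviation "\<eta> \<equiv> twist d \<phi> \<epsilon>"

lemmas \<epsilon>_measurable = coin_tossing_measurable[OF coin]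

lemma \<epsilon>_window: "\<omega> \<in> space P \<Longrightarrow> window l \<epsilon> n \<omega> \<in> cube l"
  by (rule window_in_cube[OF \<epsilon>_measurable])

lemma \<epsilon>_values: "\<omega> \<in> space P \<Longrightarrow> \<epsilon> n \<omega> \<in> {-1, 1}"
  using measurable_space[OF \<epsilon>_measurable[of n]] by simp

lemma window_tl: "window d \<epsilon> n \<omega> = tl (window d \<epsilon> (n - 1) \<omega>) @ [\<epsilon> n \<omega>]"
proof -
  obtain e where e: "d = Suc e" using d_pos by (cases d) auto
  have "window d \<epsilon> (n - 1) \<omega> = window 1 \<epsilon> (n - 1 - int e) \<omega> @ window e \<epsilon> (n - 1) \<omega>"
    using window_append[of 1 e] e by simp
  moreover have "window 1 \<epsilon> (n - 1 - int e) \<omega> = [\<epsilon> (n - 1 - int e) \<omega>]"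
    using window_Suc[of 0] by simp
  ultimately show ?thesis by (simp add: e window_Suc[of e \<epsilon> n])
qed

lemma twist_mult: "\<omega> \<in> space P \<Longrightarrow> \<eta> n \<omega> * \<phi> (window d \<epsilon> (n - 1) \<omega>) = \<epsilon> n \<omega>"
  using \<phi>_cases[OF \<epsilon>_window[of \<omega> d "n - 1"]] by (auto simp: twist_def)

lemma window_step: "\<omega> \<in> space P \<Longrightarrow> window d \<epsilon> n \<omega> = shift_map \<phi> (\<eta> n \<omega>) (window d \<epsilon> (n - 1) \<omega>)"
  by (simp add: shift_map_def twist_mult window_tl[of n])

lemma window_act:
  "\<omega> \<in> space P \<Longrightarrow> window d \<epsilon> n \<omega> = act (window l \<eta> n \<omega>) (window d \<epsilon> (n - int l) \<omega>)"
proof (induction l arbitrary: n)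
  case (Suc l)
  have "window d \<epsilon> n \<omega> = shift_map \<phi> (\<eta> n \<omega>) (act (window l \<eta> (n - 1) \<omega>) (window d \<epsilon> (n - 1 - int l) \<omega>))"
    using window_step[OF Suc.prems, of n] Suc.IH[OF Suc.prems, of "n - 1"] by simp
  then show ?case by (simp add: window_Suc algebra_simps)
qed simp

lemma window_read:
  "\<omega> \<in> space P \<Longrightarrow> window l \<eta> (a + int l) \<omega> = read (window d \<epsilon> a \<omega>) (window l \<epsilon> (a + int l) \<omega>)"
proof (induction l arbitrary: a)
  case (Suc l)
  have "window l \<eta> (a + 1 + int l) \<omega> = read (window d \<epsilon> (a + 1) \<omega>) (window l \<epsilon> (a + 1 + int l) \<omega>)"
    by (rule Suc.IH[OF Suc.prems])
  then show ?case
    unfolding window_Cons by (simp add: window_tl[of "a + 1"] twist_def)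
qed simp

lemma twist_measurable_past:
  assumes "\<And>k. k \<le> n \<Longrightarrow> \<epsilon> k \<in> N \<rightarrow>\<^sub>M count_space UNIV"
  shows "\<eta> n \<in> N \<rightarrow>\<^sub>M count_space UNIV"
proof -
  have "\<eta> n = (\<lambda>\<omega>. (\<lambda>w. \<phi> (butlast w) * last w) (window (Suc d) \<epsilon> n \<omega>))"
    by (simp add: fun_eq_iff twist_def window_Suc)
  then show ?thesis
    using measurable_compose[OF measurable_window[OF assms, where l = "Suc d"],
        where g = "\<lambda>w. \<phi> (butlast w) * last w" and L = "count_space UNIV"] by simp
qed

lemma twist_values: "\<omega> \<in> space P \<Longrightarrow> \<eta> n \<omega> \<in> {-1, 1}"
  using \<phi>_cases[OF \<epsilon>_window[of \<omega> d "n - 1"]] \<epsilon>_values[of \<omega> n] by (auto simp: twist_def)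

lemma twist_measurable: "\<eta> n \<in> P \<rightarrow>\<^sub>M count_space {-1, 1}"
proof (rule measurable_count_space_eq2[THEN iffD2], simp, intro conjI ballI)
  show "\<eta> n \<in> space P \<rightarrow> {-1, 1}" using twist_values by blast
  show "\<eta> n -` {a} \<inter> space P \<in> sets P" for a
    by (rule measurable_sets[OF twist_measurable_past[OF measurable_signs_UNIV[OF \<epsilon>_measurable]]]) simp
qed

text \<open>
  The pair is a bijective recoding, by \<open>emit\<close> and \<open>read\<close>, of \<open>d + l\<close> consecutive tosses. So
  the state at time \<open>a\<close> is uniform and independent of the twisted tosses that follow, which are
  themselves uniform.
\<close>

theorem uniform_state_and_future:
  "measure P {\<omega> \<in> space P. (window d \<epsilon> a \<omega>, window l \<eta> (a + int l) \<omega>) \<in> T}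
    = card (T \<inter> cube d \<times> cube l) / 2 ^ (d + l)"
proof -
  interpret prob_space P by (rule coin_tossing_prob_space[OF coin])
  let ?Y = "\<lambda>\<omega>. (window d \<epsilon> a \<omega>, window l \<eta> (a + int l) \<omega>)"
  let ?code = "\<lambda>u. (take d u, read (take d u) (drop d u))"
  have W: "window (d + l) \<epsilon> (a + int l) \<omega> = window d \<epsilon> a \<omega> @ window l \<epsilon> (a + int l) \<omega>" for \<omega>
    by (simp add: window_append)
  have Y: "?Y \<omega> = ?code (window (d + l) \<epsilon> (a + int l) \<omega>)" if "\<omega> \<in> space P" for \<omega>
    using that by (simp add: W window_read)
  have "measure P {\<omega> \<in> space P. ?Y \<omega> \<in> T} = card (T \<inter> cube d \<times> cube l) * (1 / 2 ^ (d + l))"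
  proof (rule measure_equal_atoms)
    have "(\<lambda>\<omega>. ?code (window (d + l) \<epsilon> (a + int l) \<omega>)) \<in> P \<rightarrow>\<^sub>M count_space UNIV"
      by (rule measurable_compose[OF measurable_window[OF measurable_signs_UNIV[OF \<epsilon>_measurable]]]) simp
    then show "?Y \<in> P \<rightarrow>\<^sub>M count_space UNIV"
      by (rule measurable_cong[THEN iffD2, rotated]) (rule Y)
    show "?Y \<in> space P \<rightarrow> cube d \<times> cube l"
      using \<epsilon>_window window_in_cube[of \<eta>, OF twist_measurable] by blast
    show "measure P {\<omega> \<in> space P. ?Y \<omega> = y} = 1 / 2 ^ (d + l)" if "y \<in> cube d \<times> cube l" for y
    proof -
      obtain x w where y: "y = (x, w)" and x: "x \<in> cube d" and w: "w \<in> cube l"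
        using \<open>y \<in> cube d \<times> cube l\<close> by blast
      have words: "set w \<subseteq> {-1, 1}" using w by (simp add: cube_def)
      have "?Y \<omega> = y \<longleftrightarrow> window (d + l) \<epsilon> (a + int l) \<omega> = x @ emit x w" if \<omega>: "\<omega> \<in> space P" for \<omega>
      proof
        assume eq: "?Y \<omega> = y"
        then have x': "window d \<epsilon> a \<omega> = x" and w': "window l \<eta> (a + int l) \<omega> = w"
          by (auto simp: y)
        have "w = read x (window l \<epsilon> (a + int l) \<omega>)"
          using window_read[OF \<omega>, of l a] unfolding x' w' .
        moreover have "set (window l \<epsilon> (a + int l) \<omega>) \<subseteq> {-1, 1}"
          using \<epsilon>_window[OF \<omega>, of l "a + int l"] by (simp add: cube_def)
        ultimately have "window l \<epsilon> (a + int l) \<omega> = emit x w"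
          using emit_read[OF x] by metis
        then show "window (d + l) \<epsilon> (a + int l) \<omega> = x @ emit x w"
          by (simp add: W x')
      next
        assume eq: "window (d + l) \<epsilon> (a + int l) \<omega> = x @ emit x w"
        have "length x = d" using x by (simp add: cube_def)
        then show "?Y \<omega> = y"
          using read_emit[OF x words] by (simp only: Y[OF \<omega>] eq y) simp
      qed
      then have "{\<omega> \<in> space P. ?Y \<omega> = y} = {\<omega> \<in> space P. window (d + l) \<epsilon> (a + int l) \<omega> = x @ emit x w}"
        by blast
      moreover have "x @ emit x w \<in> cube (d + l)"
        using emit_cube[OF x w] x by (auto simp: cube_def)
      ultimately show ?thesis using coin_tossing_window[OF coin] by simp
    qed
  qed simp
  then show ?thesis by simp
qed

theorem twist_coin_tossing: "coin_tossing P \<eta>"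
proof (rule coin_tossing_transfer[OF coin coin_tossing_prob_space[OF coin] twist_measurable])
  fix l n and w :: "int list" assume w: "w \<in> cube l"
  have "{\<omega> \<in> space P. window l \<eta> n \<omega> = w}
      = {\<omega> \<in> space P. (window d \<epsilon> (n - int l) \<omega>, window l \<eta> (n - int l + int l) \<omega>) \<in> UNIV \<times> {w}}"
    by auto
  moreover have "(UNIV \<times> {w}) \<inter> cube d \<times> cube l = cube d \<times> {w}" using w by auto
  ultimately show "measure P {\<omega> \<in> space P. window l \<eta> n \<omega> = w} = 1 / 2 ^ l"
    using uniform_state_and_future[of "n - int l" l "UNIV \<times> {w}"]
    by (simp add: power_add card_cartesian_product)
qed

end

section \<open>Coupling from the past\<close>

lemma measurable_sigma_generated:
  assumes "G \<subseteq> Pow \<Omega>" and "\<And>B. f -` B \<inter> \<Omega> \<in> G"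
  shows "f \<in> sigma \<Omega> G \<rightarrow>\<^sub>M count_space UNIV"
  using assms by (intro measurableI) (simp_all add: space_measure_of sets_measure_of)

context cube_automaton
begin

text \<open>
  The image of the cube under the past of the sequence. On the null event where no finite past is
  synchronizing, an arbitrary synchronizing word is used, so that the limit set is always a
  recurrent state.
\<close>

definition limit_word :: "(int \<Rightarrow> 'b \<Rightarrow> int) \<Rightarrow> int \<Rightarrow> 'b \<Rightarrow> int list" where
  "limit_word \<zeta> n \<omega> =
     (if \<exists>l. sync (window l \<zeta> n \<omega>) then window (LEAST l. sync (window l \<zeta> n \<omega>)) \<zeta> n \<omega>
      else SOME w. sync w)"

definition limit_set :: "(int \<Rightarrow> 'b \<Rightarrow> int) \<Rightarrow> int \<Rightarrow> 'b \<Rightarrow> int list set" where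
  "limit_set \<zeta> n \<omega> = act (limit_word \<zeta> n \<omega>) ` cube d"

lemma sync_limit_word: "sync (limit_word \<zeta> n \<omega>)"
proof (cases "\<exists>l. sync (window l \<zeta> n \<omega>)")
  case True
  show ?thesis
    unfolding limit_word_def if_P[OF True] using True by (rule LeastI_ex)
next
  case False
  show ?thesis
    unfolding limit_word_def if_not_P[OF False] by (rule someI_ex[OF ex_sync])
qed

lemma limit_set_recurrent: "limit_set \<zeta> n \<omega> \<in> recurrent_class d \<phi>"
  unfolding limit_set_def by (rule sync_image_recurrent[OF sync_limit_word])

lemma limit_set_eq:
  assumes signs: "\<And>k. \<zeta> k \<omega> \<in> {-1, 1}" and sync: "sync (window l \<zeta> n \<omega>)"
  shows "limit_set \<zeta> n \<omega> = act (window l \<zeta> n \<omega>) ` cube d"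
proof -
  let ?m = "LEAST l. sync (window l \<zeta> n \<omega>)"
  have ex: "\<exists>l. sync (window l \<zeta> n \<omega>)" using sync by (rule exI)
  have m: "sync (window ?m \<zeta> n \<omega>)" using ex by (rule LeastI_ex)
  have "?m \<le> l" using sync by (rule Least_le)
  then have "window l \<zeta> n \<omega> = window (l - ?m) \<zeta> (n - int ?m) \<omega> @ window ?m \<zeta> n \<omega>"
    using window_append[of "l - ?m" ?m \<zeta> n \<omega>] by simp
  moreover have "set (window (l - ?m) \<zeta> (n - int ?m) \<omega>) \<subseteq> {-1, 1}"
    using signs by (auto simp: window_def)
  ultimately have "act (window l \<zeta> n \<omega>) ` cube d = act (window ?m \<zeta> n \<omega>) ` cube d"
    using sync_image_forget_past[OF m] by metis
  then show ?thesis
    unfolding limit_set_def limit_word_def if_P[OF ex] by (rule sym)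
qed

lemma limit_set_step:
  assumes signs: "\<And>k. \<zeta> k \<omega> \<in> {-1, 1}" and sync: "sync (window l \<zeta> (n - 1) \<omega>)"
  shows "limit_set \<zeta> n \<omega> = shift_map \<phi> (\<zeta> n \<omega>) ` limit_set \<zeta> (n - 1) \<omega>"
proof -
  have "sync (window (Suc l) \<zeta> n \<omega>)"
    unfolding window_Suc using signs[of n] by (intro sync_append sync) simp
  note limit_set_eq[of \<zeta> \<omega>, OF signs this]
  moreover note limit_set_eq[of \<zeta> \<omega>, OF signs sync]
  ultimately show ?thesis by (simp add: window_Suc image_image)
qed

lemma measurable_limit_set_UNIV:
  assumes "\<And>k. k \<le> n \<Longrightarrow> \<zeta> k \<in> N \<rightarrow>\<^sub>M count_space UNIV"
  shows "limit_set \<zeta> n \<in> N \<rightarrow>\<^sub>M count_space UNIV"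
proof -
  have w: "(\<lambda>\<omega>. window l \<zeta> n \<omega>) \<in> N \<rightarrow>\<^sub>M count_space UNIV" for l
    using measurable_window[OF assms] .
  have s [measurable]: "Measurable.pred N (\<lambda>\<omega>. sync (window l \<zeta> n \<omega>))" for l
    using measurable_compose[OF w, of sync "count_space UNIV"] by simp
  have L: "(\<lambda>\<omega>. LEAST l. sync (window l \<zeta> n \<omega>)) \<in> N \<rightarrow>\<^sub>M count_space UNIV"
    by (rule measurable_Least[OF s])
  have "(\<lambda>\<omega>. window (LEAST l. sync (window l \<zeta> n \<omega>)) \<zeta> n \<omega>) \<in> N \<rightarrow>\<^sub>M count_space UNIV"
    by (rule measurable_compose_countable[OF w L])
  moreover have "{\<omega> \<in> space N. \<exists>l. sync (window l \<zeta> n \<omega>)} \<in> sets N"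
    by measurable
  ultimately have "limit_word \<zeta> n \<in> N \<rightarrow>\<^sub>M count_space UNIV"
    unfolding limit_word_def[abs_def] by (intro measurable_If) simp_all
  then show ?thesis
    unfolding limit_set_def[abs_def] by (rule measurable_compose) simp
qed

lemma finite_recurrent_class: "finite (recurrent_class d \<phi>)"
  by (rule finite_subset[of _ "Pow (cube d)"]) (auto simp: recurrent_class_def)

lemma measurable_limit_set:
  assumes "\<And>k. k \<le> n \<Longrightarrow> \<zeta> k \<in> N \<rightarrow>\<^sub>M count_space UNIV"
  shows "limit_set \<zeta> n \<in> N \<rightarrow>\<^sub>M count_space (recurrent_class d \<phi>)"
  unfolding measurable_count_space_eq2[OF finite_recurrent_class]
proof (intro conjI ballI)
  show "limit_set \<zeta> n \<in> space N \<rightarrow> recurrent_class d \<phi>"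
    by (intro Pi_I limit_set_recurrent)
  show "limit_set \<zeta> n -` {A} \<inter> space N \<in> sets N" for A
    by (rule measurable_sets[OF measurable_limit_set_UNIV[OF assms]]) simp_all
qed

text \<open>
  The probability that no window of length at most \<open>l\<close> is synchronizing is the density of the
  words of length \<open>l\<close> that are not synchronizing.
\<close>

lemma AE_sync:
  assumes c: "coin_tossing P \<zeta>"
  shows "AE \<omega> in P. \<forall>n. \<exists>l. sync (window l \<zeta> n \<omega>)"
proof -
  interpret prob_space P by (rule coin_tossing_prob_space[OF c])
  note m = coin_tossing_measurable[OF c]
  note m' = measurable_signs_UNIV[OF m]
  have "AE \<omega> in P. \<exists>l. sync (window l \<zeta> n \<omega>)" for n
  proof -
    let ?N = "{\<omega> \<in> space P. \<forall>l. \<not> sync (window l \<zeta> n \<omega>)}"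
    have ev: "{\<omega> \<in> space P. \<not> sync (window l \<zeta> n \<omega>)} \<in> sets P" for l
      by (rule sets_window_event[OF m'])
    have N: "?N \<in> sets P"
      by (intro sets.sets_Collect_countable_All ev)
    have "prob ?N \<le> real (card {w \<in> cube l. \<not> sync w}) / 2 ^ l" for l
    proof -
      have "prob ?N \<le> prob {\<omega> \<in> space P. window l \<zeta> n \<omega> \<in> {w. \<not> sync w}}"
        using ev[of l] by (intro finite_measure_mono) auto
      also have "\<dots> = real (card ({w. \<not> sync w} \<inter> cube l)) * (1 / 2 ^ l)"
      proof (rule measure_equal_atoms)
        show "window l \<zeta> n \<in> P \<rightarrow>\<^sub>M count_space UNIV" by (rule measurable_window[OF m'])
        show "window l \<zeta> n \<in> space P \<rightarrow> cube l" by (intro Pi_I window_in_cube[OF m])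
      qed (auto intro: coin_tossing_window[OF c])
      also have "{w. \<not> sync w} \<inter> cube l = {w \<in> cube l. \<not> sync w}" by blast
      finally show ?thesis by simp
    qed
    then have "prob ?N \<le> 0"
      by (intro LIMSEQ_le_const[OF density_not_sync]) auto
    then have "prob ?N = 0" by (simp add: measure_le_0_iff)
    then have "?N \<in> null_sets P"
      using N by (simp add: null_sets_def emeasure_eq_measure)
    then show ?thesis by (rule AE_I') auto
  qed
  then show ?thesis by (simp add: AE_all_countable)
qed

lemma values_of_coin:
  assumes c: "coin_tossing P \<zeta>" and "\<omega> \<in> space P"
  shows "\<zeta> k \<omega> \<in> {-1, 1}"
  using measurable_space[OF coin_tossing_measurable[OF c] assms(2)] by simp

lemma AE_limit_set_step:
  assumes c: "coin_tossing P \<zeta>"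
  shows "AE \<omega> in P. \<forall>n. limit_set \<zeta> n \<omega> = shift_map \<phi> (\<zeta> n \<omega>) ` limit_set \<zeta> (n - 1) \<omega>"
  using AE_sync[OF c] AE_space
proof eventually_elim
  fix \<omega> assume sync: "\<forall>n. \<exists>l. sync (window l \<zeta> n \<omega>)" and \<omega>: "\<omega> \<in> space P"
  show "\<forall>n. limit_set \<zeta> n \<omega> = shift_map \<phi> (\<zeta> n \<omega>) ` limit_set \<zeta> (n - 1) \<omega>"
  proof
    fix n
    obtain l where "sync (window l \<zeta> (n - 1) \<omega>)" using sync by blast
    then show "limit_set \<zeta> n \<omega> = shift_map \<phi> (\<zeta> n \<omega>) ` limit_set \<zeta> (n - 1) \<omega>"
      by (rule limit_set_step[of \<zeta> \<omega>, OF values_of_coin[OF c \<omega>]])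
  qed
qed

end

lemma coin_toss_indep_past:
  assumes c: "coin_tossing P \<zeta>"
    and A: "A \<in> sigma_sets (space P) {\<zeta> k -` B \<inter> space P | k B. k \<le> n - 1}"
    and a: "a \<in> {-1, 1}"
  shows "measure P (A \<inter> (\<zeta> n -` {a} \<inter> space P)) = measure P A / 2"
proof -
  interpret prob_space P by (rule coin_tossing_prob_space[OF c])
  let ?E = "\<lambda>k. {\<zeta> k -` B \<inter> space P | B. B \<in> sets (count_space {-1, 1})}"
  have "indep_vars (\<lambda>_. count_space {-1, 1}) \<zeta> UNIV"
    using c unfolding coin_tossing_def by (elim conjE)
  then have "indep_sets ?E UNIV"
    unfolding indep_vars_def2 by (rule conjunct2)
  then have "indep_sets ?E (\<Union>j\<in>UNIV. case_bool {..n - 1} {n} j)"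
    by (rule indep_sets_mono_index[rotated]) simp
  then have "indep_sets (\<lambda>j. sigma_sets (space P) (\<Union>k\<in>case_bool {..n - 1} {n} j. ?E k)) UNIV"
  proof (rule indep_sets_collect_sigma)
    show "Int_stable (?E k)" for k
    proof (rule Int_stableI)
      fix a b assume "a \<in> ?E k" "b \<in> ?E k"
      then obtain B C where "a = \<zeta> k -` B \<inter> space P" "b = \<zeta> k -` C \<inter> space P"
        "B \<subseteq> {-1, 1}" "C \<subseteq> {-1, 1}" by auto
      then show "a \<inter> b \<in> ?E k" by (auto intro!: exI[of _ "B \<inter> C"])
    qed
    show "disjoint_family_on (case_bool {..n - 1} {n}) UNIV"
      by (auto simp: disjoint_family_on_def split: bool.splits)
  qed
  moreover have "(\<lambda>j. sigma_sets (space P) (\<Union>k\<in>case_bool {..n - 1} {n} j. ?E k))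
      = case_bool (sigma_sets (space P) (\<Union>k\<in>{..n - 1}. ?E k)) (sigma_sets (space P) (?E n))"
    by (auto simp: fun_eq_iff split: bool.splits)
  ultimately have ind: "indep_set (sigma_sets (space P) (\<Union>k\<in>{..n - 1}. ?E k)) (sigma_sets (space P) (?E n))"
    by (simp add: indep_set_def)
  have "{\<zeta> k -` B \<inter> space P | k B. k \<le> n - 1} \<subseteq> (\<Union>k\<in>{..n - 1}. ?E k)"
  proof safe
    fix k :: int and B :: "int set" assume k: "k \<le> n - 1"
    have "\<zeta> k -` B \<inter> space P = \<zeta> k -` (B \<inter> {-1, 1}) \<inter> space P"
      using measurable_space[OF coin_tossing_measurable[OF c], of _ k] by auto
    moreover have "B \<inter> {-1, 1} \<in> sets (count_space {-1, 1})" by simp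
    ultimately have "\<zeta> k -` B \<inter> space P \<in> ?E k" by blast
    then show "\<zeta> k -` B \<inter> space P \<in> (\<Union>k\<in>{..n - 1}. ?E k)"
      using k by (intro UN_I[of k]) simp_all
  qed
  from sigma_sets_mono'[OF this] A have "A \<in> sigma_sets (space P) (\<Union>k\<in>{..n - 1}. ?E k)"
    by (rule subsetD)
  moreover have "\<zeta> n -` {a} \<inter> space P \<in> sigma_sets (space P) (?E n)"
    using a by auto
  ultimately have "prob (A \<inter> (\<zeta> n -` {a} \<inter> space P)) = prob A * prob (\<zeta> n -` {a} \<inter> space P)"
    by (rule indep_setD[OF ind])
  then show ?thesis by (simp add: coin_tossing_prob_eq[OF c a])
qed

context cube_automaton
begin

text \<open>
  The limit set at time \<open>n - 1\<close> is a function of the tosses up to \<open>n - 1\<close>, and the next one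
  arises from it by the map of an independent toss.
\<close>

lemma limit_set_markov_chain:
  assumes c: "coin_tossing Q \<zeta>"
  shows "markov_chain Q (recurrent_class d \<phi>) (set_kernel \<phi>) (limit_set \<zeta>)"
proof -
  interpret prob_space Q by (rule coin_tossing_prob_space[OF c])
  let ?X = "limit_set \<zeta>"
  note m = coin_tossing_measurable[OF c]
  note m' = measurable_signs_UNIV[OF m]
  have X: "?X n \<in> Q \<rightarrow>\<^sub>M count_space (recurrent_class d \<phi>)" for n
    by (rule measurable_limit_set[OF m'])
  have "AE \<omega> in Q. real_cond_exp Q (sigma (space Q) {?X k -` B \<inter> space Q | k B. k \<le> n - 1})
      (indicator {\<omega> \<in> space Q. ?X n \<omega> = s}) \<omega> = pmf (set_kernel \<phi> (?X (n - 1) \<omega>)) s" for n s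
  proof -
    let ?G = "{?X k -` B \<inter> space Q | k B. k \<le> n - 1}"
    let ?H = "{\<zeta> k -` B \<inter> space Q | k B. k \<le> n - 1}"
    let ?F = "sigma (space Q) ?G"
    let ?N = "sigma (space Q) ?H"
    have G: "?G \<subseteq> Pow (space Q)" and H: "?H \<subseteq> Pow (space Q)" by auto
    have \<zeta>N: "\<zeta> k \<in> ?N \<rightarrow>\<^sub>M count_space UNIV" if "k \<le> n - 1" for k
      by (rule measurable_sigma_generated[OF H]) (use that in blast)
    have XN: "?X k \<in> ?N \<rightarrow>\<^sub>M count_space UNIV" if "k \<le> n - 1" for k
      using that by (intro measurable_limit_set_UNIV \<zeta>N) simp
    have F_N: "sets ?F \<subseteq> sets ?N"
      unfolding sets_measure_of[OF G]
    proof (rule sets.sigma_sets_subset')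
      show "?G \<subseteq> sets ?N"
      proof safe
        fix k :: int and B :: "int list set set" assume k: "k \<le> n - 1"
        have "?X k -` B \<inter> space ?N \<in> sets ?N"
          by (rule measurable_sets[OF XN[OF k]]) simp
        then show "?X k -` B \<inter> space Q \<in> sets ?N"
          using H by (simp add: space_measure_of)
      qed
      show "space Q \<in> sets ?N"
        unfolding sets_measure_of[OF H] by (rule sigma_sets_top)
    qed
    have "sets ?N \<subseteq> sets Q"
      unfolding sets_measure_of[OF H]
      by (rule sets.sigma_sets_subset) (auto intro: measurable_sets[OF m'])
    then have sub: "subalgebra Q ?F"
      using F_N G by (auto simp: subalgebra_def space_measure_of)
    interpret finite_measure_subalgebra Q ?F
      by unfold_locales (rule sub)
    have XF: "?X (n - 1) \<in> ?F \<rightarrow>\<^sub>M count_space UNIV"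
      by (rule measurable_sigma_generated[OF G]) blast
    let ?g = "\<lambda>\<omega>. pmf (set_kernel \<phi> (?X (n - 1) \<omega>)) s"
    let ?D = "\<lambda>a. {\<omega> \<in> space Q. shift_map \<phi> a ` ?X (n - 1) \<omega> = s}"
    have DN: "?D a \<in> sets ?N" for a
    proof -
      have "?X (n - 1) -` {B. shift_map \<phi> a ` B = s} \<inter> space ?N \<in> sets ?N"
        by (rule measurable_sets[OF XN]) simp_all
      moreover have "?X (n - 1) -` {B. shift_map \<phi> a ` B = s} \<inter> space ?N = ?D a"
        using H by (auto simp: space_measure_of)
      ultimately show ?thesis by simp
    qed
    have DQ: "?D a \<in> sets Q" for a
      using DN \<open>sets ?N \<subseteq> sets Q\<close> by blast
    have XQ: "{\<omega> \<in> space Q. ?X n \<omega> = s} \<in> sets Q"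
    proof -
      have "?X n -` {s} \<inter> space Q \<in> sets Q"
        by (rule measurable_sets[OF measurable_limit_set_UNIV[OF m']]) simp
      moreover have "?X n -` {s} \<inter> space Q = {\<omega> \<in> space Q. ?X n \<omega> = s}" by auto
      ultimately show ?thesis by simp
    qed
    have g: "?g \<omega> = (indicator (?D 1) \<omega> + indicator (?D (-1)) \<omega>) / 2" if "\<omega> \<in> space Q" for \<omega>
      using that unfolding pmf_set_kernel by (simp add: indicator_def)
    have g_meas: "?g \<in> borel_measurable ?F"
      by (rule measurable_compose[OF XF]) simp
    show ?thesis
    proof (rule real_cond_exp_charact)
      show "?g \<in> borel_measurable ?F" by (rule g_meas)
      show "integrable Q (indicator {\<omega> \<in> space Q. ?X n \<omega> = s} :: _ \<Rightarrow> real)"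
        using XQ by (simp add: integrable_indicator_iff emeasure_eq_measure)
      have "integrable Q (\<lambda>\<omega>. (indicator (?D 1) \<omega> + indicator (?D (-1)) \<omega>) / 2 :: real)"
        using DQ by (intro integrable_divide integrable_add) (simp_all add: integrable_indicator_iff emeasure_eq_measure)
      then show "integrable Q ?g"
        by (rule Bochner_Integration.integrable_cong[THEN iffD2, rotated 2]) (auto simp: g)
      fix A assume A: "A \<in> sets ?F"
      have AN: "A \<in> sets ?N" using A F_N by blast
      then have AQ: "A \<in> sets Q" using \<open>sets ?N \<subseteq> sets Q\<close> by blast
      have AE: "AE \<omega> in Q. ?X n \<omega> = shift_map \<phi> (\<zeta> n \<omega>) ` ?X (n - 1) \<omega>"
        using AE_limit_set_step[OF c] by eventually_elim blast
      let ?V = "\<lambda>a. \<zeta> n -` {a} \<inter> space Q"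
      have VQ: "?V a \<in> sets Q" for a
        by (rule measurable_sets[OF m']) simp
      have half: "prob (A \<inter> ?D a \<inter> ?V a) = prob (A \<inter> ?D a) / 2" if "a \<in> {-1, 1}" for a
      proof (rule coin_toss_indep_past[OF c _ that])
        show "A \<inter> ?D a \<in> sigma_sets (space Q) ?H"
          using sets.Int[OF AN DN] unfolding sets_measure_of[OF H] .
      qed
      have "(\<integral>\<omega>\<in>A. indicator {\<omega> \<in> space Q. ?X n \<omega> = s} \<omega> \<partial>Q) = prob (A \<inter> {\<omega> \<in> space Q. ?X n \<omega> = s})"
        using AQ XQ by (simp add: set_lebesgue_integral_def indicator_inter_arith[symmetric])
      also have "\<dots> = prob ((A \<inter> ?D 1 \<inter> ?V 1) \<union> (A \<inter> ?D (-1) \<inter> ?V (-1)))"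
      proof (rule finite_measure_eq_AE)
        show "AE \<omega> in Q. (\<omega> \<in> A \<inter> {\<omega> \<in> space Q. ?X n \<omega> = s})
            = (\<omega> \<in> (A \<inter> ?D 1 \<inter> ?V 1) \<union> (A \<inter> ?D (-1) \<inter> ?V (-1)))"
          using AE AE_space
        proof eventually_elim
          case (elim \<omega>)
          then show ?case using values_of_coin[OF c elim(2), of n] by auto
        qed
      qed (use AQ XQ DQ VQ in auto)
      also have "\<dots> = prob (A \<inter> ?D 1 \<inter> ?V 1) + prob (A \<inter> ?D (-1) \<inter> ?V (-1))"
        using AQ DQ VQ by (intro finite_measure_Union) auto
      also have "\<dots> = prob (A \<inter> ?D 1) / 2 + prob (A \<inter> ?D (-1)) / 2"
        by (simp add: half)
      also have "\<dots> = (\<integral>\<omega>. (indicator (A \<inter> ?D 1) \<omega> + indicator (A \<inter> ?D (-1)) \<omega>) / 2 \<partial>Q)"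
        using AQ DQ by (simp add: emeasure_eq_measure integrable_indicator_iff)
      also have "\<dots> = (\<integral>\<omega>\<in>A. ?g \<omega> \<partial>Q)"
        unfolding set_lebesgue_integral_def
        by (rule Bochner_Integration.integral_cong) (auto simp: g indicator_def)
      finally show "(\<integral>\<omega>\<in>A. indicator {\<omega> \<in> space Q. ?X n \<omega> = s} \<omega> \<partial>Q) = (\<integral>\<omega>\<in>A. ?g \<omega> \<partial>Q)" .
    qed
  qed
  then show ?thesis
    using X prob_space_axioms by (simp add: markov_chain_def)
qed

text \<open>
  The limit sets form a chain governed by the tosses, so the defining property of \<open>F\<close> applies to
  them. That property speaks about measures on paths of pairs; the law of the tosses is moved there,
  with the empty set as a dummy second component.
\<close>

theorem past_map_eq_limit_set:
  assumes c: "coin_tossing P \<zeta>" and F: "is_past_map d \<phi> F"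
  shows "AE \<omega> in P. \<forall>n. limit_set \<zeta> n \<omega> = F (past (\<lambda>k. \<zeta> k \<omega>) n)"
proof -
  interpret prob_space P by (rule coin_tossing_prob_space[OF c])
  note m = coin_tossing_measurable[OF c]
  let ?S = "{-1, 1} \<times> {{}} :: (int \<times> int list set) set"
  let ?M = "PiM UNIV (\<lambda>_ :: int. count_space ?S)"
  let ?h = "\<lambda>\<omega> k. (\<zeta> k \<omega>, {} :: int list set)"
  let ?Q = "distr P ?M ?h"
  let ?\<eta> = "\<lambda>k q. fst (q k) :: int"
  have h: "?h \<in> P \<rightarrow>\<^sub>M ?M"
  proof (rule measurable_PiM_single')
    fix k
    show "(\<lambda>\<omega>. (\<zeta> k \<omega>, {} :: int list set)) \<in> P \<rightarrow>\<^sub>M count_space ?S"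
      by (rule measurable_compose[OF m]) simp
  qed (use values_of_coin[OF c] in auto)
  have \<eta>: "?\<eta> k \<in> ?Q \<rightarrow>\<^sub>M count_space {-1, 1}" for k
  proof -
    have "(\<lambda>q. q k) \<in> ?M \<rightarrow>\<^sub>M count_space ?S"
      by (rule measurable_component_singleton) simp
    then have "(\<lambda>q. fst (q k)) \<in> ?M \<rightarrow>\<^sub>M count_space {-1, 1}"
      by (rule measurable_compose) auto
    then show ?thesis by simp
  qed
  have win: "window l ?\<eta> n (?h \<omega>) = window l \<zeta> n \<omega>" for l n \<omega>
    by (rule window_cong) simp
  have Q: "prob_space ?Q" by (rule prob_space_distr[OF h])
  have coin: "coin_tossing ?Q ?\<eta>"
  proof (rule coin_tossing_transfer[OF c Q \<eta>])
    fix l n and w :: "int list" assume w: "w \<in> cube l"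
    have ev: "{q \<in> space ?Q. window l ?\<eta> n q = w} \<in> sets ?M"
      using sets_window_event[of n ?\<eta> ?Q "\<lambda>u. u = w" l, OF measurable_signs_UNIV[OF \<eta>]] by simp
    have "measure ?Q {q \<in> space ?Q. window l ?\<eta> n q = w}
        = prob (?h -` {q \<in> space ?Q. window l ?\<eta> n q = w} \<inter> space P)"
      by (rule measure_distr[OF h ev])
    also have "?h -` {q \<in> space ?Q. window l ?\<eta> n q = w} \<inter> space P
        = {\<omega> \<in> space P. window l \<zeta> n \<omega> = w}"
      using measurable_space[OF h] win by auto
    also have "prob \<dots> = 1 / 2 ^ l" by (rule coin_tossing_window[OF c w])
    finally show "measure ?Q {q \<in> space ?Q. window l ?\<eta> n q = w} = 1 / 2 ^ l" .
  qed
  have "AE q in ?Q. \<forall>n. limit_set ?\<eta> n q = F (past (\<lambda>k. ?\<eta> k q) n)"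
    by (rule F[unfolded is_past_map_def, THEN conjunct2, THEN spec, THEN spec, THEN spec, THEN mp])
      (intro conjI limit_set_markov_chain coin AE_limit_set_step)
  then have "AE \<omega> in P. \<forall>n. limit_set ?\<eta> n (?h \<omega>) = F (past (\<lambda>k. ?\<eta> k (?h \<omega>)) n)"
    by (rule AE_distrD[OF h])
  moreover have "limit_set ?\<eta> n (?h \<omega>) = limit_set \<zeta> n \<omega>" for n \<omega>
    unfolding limit_set_def limit_word_def win ..
  ultimately show ?thesis by simp
qed

end

section \<open>Completed sigma-fields\<close>

lemma completed_field_subset:
  assumes "G \<subseteq> completed_field P H"
  shows "completed_field P G \<subseteq> completed_field P H"
  unfolding completed_field_def
proof (rule sigma_sets_mono)
  have "null_sets (completion P) \<subseteq> sigma_sets (space P) (H \<union> null_sets (completion P))"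
    by (auto intro: sigma_sets.Basic)
  with assms show "G \<union> null_sets (completion P) \<subseteq> sigma_sets (space P) (H \<union> null_sets (completion P))"
    unfolding completed_field_def by (rule Un_least)
qed

lemma subset_completed_field: "G \<subseteq> completed_field P G"
  unfolding completed_field_def by (auto intro: sigma_sets.Basic)

lemma null_sets_completed_field: "null_sets (completion P) \<subseteq> completed_field P G"
  unfolding completed_field_def by (auto intro: sigma_sets.Basic)

text \<open>
  A measure space whose only purpose is to carry a completed field, so that the notion of a
  measurable map is available for it.
\<close>

definition completed_measure :: "'a measure \<Rightarrow> 'a set set \<Rightarrow> 'a measure" where
  "completed_measure P G = sigma (space P) (completed_field P G)"

lemma completed_measure_simps:
  assumes "G \<subseteq> Pow (space P)"
  shows "space (completed_measure P G) = space P"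
    and "sets (completed_measure P G) = completed_field P G"
proof -
  have "null_sets (completion P) \<subseteq> Pow (space P)"
    using sets.sets_into_space[of _ "completion P"] by (auto simp: null_sets_def)
  with assms interpret sigma_algebra "space P" "completed_field P G"
    unfolding completed_field_def by (intro sigma_algebra_sigma_sets) simp
  show "space (completed_measure P G) = space P"
    unfolding completed_measure_def using space_closed by (rule space_measure_of)
  show "sets (completed_measure P G) = completed_field P G"
    unfolding completed_measure_def by (rule sets_measure_of_eq)
qed

lemma measurable_completed_AE:
  assumes sp: "space N = space P" and null: "null_sets (completion P) \<subseteq> sets N"
    and g: "g \<in> N \<rightarrow>\<^sub>M count_space UNIV" and ae: "AE \<omega> in P. f \<omega> = g \<omega>"
  shows "f \<in> N \<rightarrow>\<^sub>M count_space UNIV"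
proof (rule measurableI)
  fix B
  obtain D where D: "D \<in> null_sets P" "{\<omega> \<in> space P. f \<omega> \<noteq> g \<omega>} \<subseteq> D"
    using ae by (auto simp: eventually_ae_filter)
  have sub: "E \<in> sets N" if "E \<subseteq> D" for E
    using null_sets_completion_subset[OF that null_sets_completionI[OF D(1)]] null by blast
  have "g -` B \<inter> space N \<in> sets N" by (rule measurable_sets[OF g]) simp
  then have "(g -` B \<inter> space N - D) \<union> (f -` B \<inter> space N \<inter> D) \<in> sets N"
    using sub[of D] sub[of "f -` B \<inter> space N \<inter> D"] by blast
  moreover have "(g -` B \<inter> space N - D) \<union> (f -` B \<inter> space N \<inter> D) = f -` B \<inter> space N"
    using D(2) sp by auto
  ultimately show "f -` B \<inter> space N \<in> sets N" by metis
qed simp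

text \<open>
  Adding the null sets to an intersection-stable generator keeps it intersection-stable and keeps
  the product rule, since both sides vanish as soon as a null set is involved.
\<close>

lemma (in prob_space) indep_set_completed:
  assumes sub: "A \<subseteq> events" "B \<subseteq> events" and Int: "Int_stable A" "Int_stable B"
    and indep: "\<And>a b. a \<in> A \<Longrightarrow> b \<in> B \<Longrightarrow> prob (a \<inter> b) = prob a * prob b"
  shows "prob_space.indep_set (completion M) (completed_field M A) (completed_field M B)"
proof -
  interpret C: prob_space "completion M" by (rule prob_space_completion)
  let ?N = "null_sets (completion M)"
  have null: "a \<inter> b \<in> ?N" if "a \<in> ?N" for a b
    using null_sets_completion_subset[OF _ that, of "a \<inter> b"] by blast
  have null': "b \<inter> a \<in> ?N" if "a \<in> ?N" for a b
    using null_sets_completion_subset[OF _ that, of "b \<inter> a"] by blast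
  have zero: "C.prob a = 0" if "a \<in> ?N" for a
    using that by (simp add: measure_eq_0_null_sets)
  have "C.indep_set (A \<union> ?N) (B \<union> ?N)"
  proof (rule C.indep_setI)
    show "A \<union> ?N \<subseteq> C.events" "B \<union> ?N \<subseteq> C.events"
      using sub by (auto simp: null_sets_def)
    fix a b assume "a \<in> A \<union> ?N" "b \<in> B \<union> ?N"
    then consider "a \<in> A" "b \<in> B" | "a \<in> ?N" | "b \<in> ?N" by blast
    then show "C.prob (a \<inter> b) = C.prob a * C.prob b"
    proof cases
      case 1
      then have "a \<in> events" "b \<in> events" using sub by auto
      then show ?thesis using indep[OF 1] by simp
    next
      case 2
      then show ?thesis by (simp add: zero null)
    next
      case 3
      then show ?thesis by (simp add: zero null')
    qed
  qed
  moreover have "Int_stable (A \<union> ?N)" "Int_stable (B \<union> ?N)"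
    using Int null null' unfolding Int_stable_def by (meson Un_iff)+
  ultimately show ?thesis
    unfolding completed_field_def using C.indep_set_sigma_sets by simp
qed

context cube_automaton
begin

section \<open>The number of the window given the twisted sequence\<close>

lemma card_sync_number_words:
  assumes num: "\<And>v. sync v \<Longrightarrow> bij_betw (num (act v ` cube d)) (act v ` cube d) {1..M}"
  shows "M * card ({(x, u). sync (take m u) \<and> num (act (take m u) ` cube d) (act (take m u) x) \<in> B \<and> u \<in> S}
      \<inter> cube d \<times> cube l)
    = card (B \<inter> {1..M}) * card ({(x, u). sync (take m u) \<and> u \<in> S} \<inter> cube d \<times> cube l)"
proof -
  let ?U = "{u \<in> cube l. sync (take m u) \<and> u \<in> S}"
  let ?K = "\<lambda>u. {x \<in> cube d. num (act (take m u) ` cube d) (act (take m u) x) \<in> B}"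
  have "card ({(x, u). sync (take m u) \<and> num (act (take m u) ` cube d) (act (take m u) x) \<in> B \<and> u \<in> S}
      \<inter> cube d \<times> cube l) = card (SIGMA u : ?U. ?K u)"
    by (rule bij_betw_same_card[of "\<lambda>(x, u). (u, x)"])
      (auto simp: bij_betw_def inj_on_def image_iff)
  also have "\<dots> = (\<Sum>u\<in>?U. card (?K u))"
    by (subst card_SigmaI) auto
  finally have "M * card ({(x, u). sync (take m u) \<and> num (act (take m u) ` cube d) (act (take m u) x) \<in> B \<and> u \<in> S}
      \<inter> cube d \<times> cube l) = (\<Sum>u\<in>?U. M * card (?K u))"
    by (simp only: sum_distrib_left)
  also have "\<dots> = (\<Sum>u\<in>?U. card (B \<inter> {1..M}) * 2 ^ d)"
  proof (rule sum.cong)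
    fix u assume "u \<in> ?U"
    then have "sync (take m u)" by simp
    then show "M * card (?K u) = card (B \<inter> {1..M}) * 2 ^ d"
      by (intro card_sync_number num)
  qed (rule refl)
  also have "\<dots> = card (B \<inter> {1..M}) * (2 ^ d * card ?U)"
    by (simp only: sum_constant of_nat_id mult_ac)
  also have "2 ^ d * card ?U = card (cube d \<times> ?U)"
    by (simp add: card_cartesian_product)
  also have "cube d \<times> ?U = {(x, u). sync (take m u) \<and> u \<in> S} \<inter> cube d \<times> cube l"
    by auto
  finally show ?thesis .
qed

end

context coin_driven_automaton
begin

lemmas coin\<eta> = twist_coin_tossing
lemmas \<eta>_signs = values_of_coin[OF coin\<eta>]
lemmas \<eta>_measurable = measurable_signs_UNIV[OF coin_tossing_measurable[OF coin\<eta>]]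
lemmas \<epsilon>_meas = measurable_signs_UNIV[OF coin_tossing_measurable[OF coin]]

lemma window_in_limit_set:
  assumes \<omega>: "\<omega> \<in> space P" and s: "sync (window l \<eta> n \<omega>)"
  shows "window d \<epsilon> n \<omega> \<in> limit_set \<eta> n \<omega>"
proof -
  have "window d \<epsilon> (n - int l) \<omega> \<in> cube d"
    by (rule window_in_cube[OF coin_tossing_measurable[OF coin] \<omega>])
  then show ?thesis
    unfolding limit_set_eq[of \<eta> \<omega>, OF \<eta>_signs[OF \<omega>] s] window_act[OF \<omega>, of n l]
    by (rule imageI)
qed

text \<open>
  The windows are centred at \<open>n\<close>, so any two of them are nested; hence the cylinders are stable
  under intersection.
\<close>

definition cylinders :: "int \<Rightarrow> 'a set set" where
  "cylinders n = {{\<omega> \<in> space P. window (m + m) \<eta> (n + int m) \<omega> \<in> S} | m S. True}"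

lemma window_centered:
  assumes "m \<le> m'"
  shows "window (m + m) \<eta> (n + int m) \<omega>
    = take (m + m) (drop (m' - m) (window (m' + m') \<eta> (n + int m') \<omega>))"
proof -
  define j where "j = m' - m"
  have m': "m' = j + m" using assms by (simp add: j_def)
  have "window (m' + m') \<eta> (n + int m') \<omega> = window (j + (m + m + j)) \<eta> (n + int m') \<omega>"
    by (simp add: m' add_ac)
  also have "\<dots> = window j \<eta> (n - int m) \<omega> @ window (m + m) \<eta> (n + int m) \<omega> @ window j \<eta> (n + int m') \<omega>"
    unfolding window_append by (simp add: m')
  finally show ?thesis by (simp add: m')
qed

lemma cylinder_mono:
  assumes "m \<le> m'"
  shows "{\<omega> \<in> space P. window (m + m) \<eta> (n + int m) \<omega> \<in> S}
    = {\<omega> \<in> space P. window (m' + m') \<eta> (n + int m') \<omega> \<in> {u. take (m + m) (drop (m' - m) u) \<in> S}}"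
  unfolding window_centered[OF assms] by simp

lemma cylinders_Int_stable: "Int_stable (cylinders n)"
proof (rule Int_stableI)
  fix a b assume "a \<in> cylinders n" "b \<in> cylinders n"
  then obtain m S k T where
    a: "a = {\<omega> \<in> space P. window (m + m) \<eta> (n + int m) \<omega> \<in> S}" and
    b: "b = {\<omega> \<in> space P. window (k + k) \<eta> (n + int k) \<omega> \<in> T}"
    unfolding cylinders_def by blast
  have "a \<inter> b = {\<omega> \<in> space P. window (max m k + max m k) \<eta> (n + int (max m k)) \<omega> \<in>
      {u. take (m + m) (drop (max m k - m) u) \<in> S} \<inter> {u. take (k + k) (drop (max m k - k) u) \<in> T}}"
    unfolding a b cylinder_mono[OF max.cobounded1[of m k]] cylinder_mono[OF max.cobounded2[of k m]] by auto
  then show "a \<inter> b \<in> cylinders n"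
    unfolding cylinders_def by blast
qed

lemma cylinders_events: "cylinders n \<subseteq> sets P"
proof
  fix C assume "C \<in> cylinders n"
  then obtain m S where C: "C = {\<omega> \<in> space P. window (m + m) \<eta> (n + int m) \<omega> \<in> S}"
    unfolding cylinders_def by blast
  show "C \<in> sets P" unfolding C by (rule sets_window_event[OF \<eta>_measurable])
qed

lemma sync_probability_limit:
  assumes A: "A \<in> sets P"
  shows "(\<lambda>m. measure P (A \<inter> {\<omega> \<in> space P. sync (window m \<eta> n \<omega>)})) \<longlonglongrightarrow> measure P A"
proof -
  interpret prob_space P by (rule coin_tossing_prob_space[OF coin])
  let ?R = "\<lambda>m. A \<inter> {\<omega> \<in> space P. sync (window m \<eta> n \<omega>)}"
  have R: "?R m \<in> sets P" for m
    by (intro sets.Int A sets_window_event \<eta>_measurable)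
  have "incseq ?R"
  proof (rule incseq_SucI, safe)
    fix m \<omega> assume \<omega>: "\<omega> \<in> space P" and s: "sync (window m \<eta> n \<omega>)"
    have "window (Suc m) \<eta> n \<omega> = [\<eta> (n - int m) \<omega>] @ window m \<eta> n \<omega>"
      using window_append[of 1 m] by simp
    then show "sync (window (Suc m) \<eta> n \<omega>)"
      using sync_factor[OF s, of "[\<eta> (n - int m) \<omega>]" "[]"] \<eta>_signs[OF \<omega>] by simp
  qed
  then have "(\<lambda>m. measure P (?R m)) \<longlonglongrightarrow> measure P (\<Union>m. ?R m)"
    using R by (intro finite_Lim_measure_incseq) blast
  also have "measure P (\<Union>m. ?R m) = measure P A"
  proof (rule finite_measure_eq_AE)
    show "AE \<omega> in P. (\<omega> \<in> (\<Union>m. ?R m)) = (\<omega> \<in> A)"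
      using AE_sync[OF coin\<eta>] AE_space
    proof eventually_elim
      case (elim \<omega>)
      then obtain m where "sync (window m \<eta> n \<omega>)" by blast
      with elim show ?case by blast
    qed
    show "(\<Union>m. ?R m) \<in> sets P" by (rule sets.countable_UN) (use R in blast)
  qed (rule A)
  finally show ?thesis .
qed

context
  fixes num :: "int list set \<Rightarrow> int list \<Rightarrow> nat"
  assumes num: "\<forall>A\<in>recurrent_class d \<phi>. bij_betw (num A) A {1..M}"
begin

abbreviation "limit_number n \<omega> \<equiv> num (limit_set \<eta> n \<omega>) (window d \<epsilon> n \<omega>)"

lemma num_sync: "sync v \<Longrightarrow> bij_betw (num (act v ` cube d)) (act v ` cube d) {1..M}"
  using num sync_image_recurrent by blast

text \<open>
  On the event that the last \<open>m\<close> twisted tosses form a synchronizing word \<open>v\<close>, the limit set is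
  \<open>act v ` cube d\<close> and the state is the image under \<open>v\<close> of the state at time \<open>n - m\<close>, which is
  uniform and independent of the twisted tosses after \<open>n - m\<close>. As the fibres of \<open>v\<close> have equal
  size, the state is uniform on the limit set, whatever the other twisted tosses are.
\<close>

lemma number_given_sync_word:
  "M * measure P {\<omega> \<in> space P. sync (window m \<eta> n \<omega>) \<and> limit_number n \<omega> \<in> B \<and> window (m + k) \<eta> (n + int k) \<omega> \<in> S}
    = card (B \<inter> {1..M}) * measure P {\<omega> \<in> space P. sync (window m \<eta> n \<omega>) \<and> window (m + k) \<eta> (n + int k) \<omega> \<in> S}"
proof -
  let ?T = "{(x, u). sync (take m u) \<and> num (act (take m u) ` cube d) (act (take m u) x) \<in> B \<and> u \<in> S}"
  let ?T' = "{(x, u). sync (take m u) \<and> u \<in> S}"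
  let ?Y = "\<lambda>\<omega>. (window d \<epsilon> (n - int m) \<omega>, window (m + k) \<eta> (n - int m + int (m + k)) \<omega>)"
  have past: "window m \<eta> n \<omega> = take m (window (m + k) \<eta> (n + int k) \<omega>)" for \<omega>
    by (simp add: window_append)
  have time: "n - int m + int (m + k) = n + int k" by simp
  have ev: "{\<omega> \<in> space P. sync (window m \<eta> n \<omega>) \<and> limit_number n \<omega> \<in> B \<and> window (m + k) \<eta> (n + int k) \<omega> \<in> S}
      = {\<omega> \<in> space P. ?Y \<omega> \<in> ?T}"
  proof (rule Collect_cong, rule conj_cong[OF refl])
    fix \<omega> assume \<omega>: "\<omega> \<in> space P"
    have "limit_number n \<omega> = num (act (window m \<eta> n \<omega>) ` cube d) (act (window m \<eta> n \<omega>) (window d \<epsilon> (n - int m) \<omega>))"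
      if "sync (window m \<eta> n \<omega>)"
      using limit_set_eq[of \<eta> \<omega>, OF \<eta>_signs[OF \<omega>] that] window_act[OF \<omega>, of n m] by simp
    then show "(sync (window m \<eta> n \<omega>) \<and> limit_number n \<omega> \<in> B \<and> window (m + k) \<eta> (n + int k) \<omega> \<in> S)
        = (?Y \<omega> \<in> ?T)"
      unfolding time past[symmetric] mem_Collect_eq prod.case by auto
  qed
  have ev': "{\<omega> \<in> space P. sync (window m \<eta> n \<omega>) \<and> window (m + k) \<eta> (n + int k) \<omega> \<in> S} = {\<omega> \<in> space P. ?Y \<omega> \<in> ?T'}"
    unfolding time past mem_Collect_eq prod.case ..
  have "real M * card (?T \<inter> cube d \<times> cube (m + k)) = card (B \<inter> {1..M}) * real (card (?T' \<inter> cube d \<times> cube (m + k)))"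
    using arg_cong[where f = real, OF card_sync_number_words[OF num_sync, of m B S "m + k"]]
    by (simp only: of_nat_mult)
  then show ?thesis
    unfolding ev ev' uniform_state_and_future by (simp only: times_divide_eq_right)
qed

lemma limit_number_measurable: "limit_number n \<in> P \<rightarrow>\<^sub>M count_space UNIV"
proof (rule measurable_compose_countable'[where f = "\<lambda>A \<omega>. num A (window d \<epsilon> n \<omega>)"])
  show "(\<lambda>\<omega>. num A (window d \<epsilon> n \<omega>)) \<in> P \<rightarrow>\<^sub>M count_space UNIV" for A
    by (rule measurable_compose[OF measurable_window[OF \<epsilon>_meas]]) simp
  show "limit_set \<eta> n \<in> P \<rightarrow>\<^sub>M count_space (recurrent_class d \<phi>)"
    by (rule measurable_limit_set[OF \<eta>_measurable])
  show "countable (recurrent_class d \<phi>)"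
    by (rule countable_finite[OF finite_recurrent_class])
qed

lemma limit_number_event: "{\<omega> \<in> space P. limit_number n \<omega> \<in> B} \<in> sets P"
proof -
  have "limit_number n -` B \<inter> space P \<in> sets P"
    by (rule measurable_sets[OF limit_number_measurable]) simp
  moreover have "limit_number n -` B \<inter> space P = {\<omega> \<in> space P. limit_number n \<omega> \<in> B}" by blast
  ultimately show ?thesis by simp
qed

text \<open>
  Let the length of the synchronizing past tend to infinity: the events of a synchronizing past
  increase to an event of probability one.
\<close>

theorem limit_number_indep:
  assumes C: "C \<in> cylinders n"
  shows "M * measure P ({\<omega> \<in> space P. limit_number n \<omega> \<in> B} \<inter> C) = card (B \<inter> {1..M}) * measure P C"
proof -
  obtain m S where C_eq: "C = {\<omega> \<in> space P. window (m + m) \<eta> (n + int m) \<omega> \<in> S}"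
    using C unfolding cylinders_def by blast
  let ?N = "{\<omega> \<in> space P. limit_number n \<omega> \<in> B}"
  let ?R = "\<lambda>k. {\<omega> \<in> space P. sync (window k \<eta> n \<omega>)}"
  have CP: "C \<in> sets P" using C cylinders_events by blast
  have eq: "M * measure P (?N \<inter> C \<inter> ?R k) = card (B \<inter> {1..M}) * measure P (C \<inter> ?R k)" if "m \<le> k" for k
  proof -
    let ?S = "{u. take (m + m) (drop (k - m) u) \<in> S}"
    have C': "C = {\<omega> \<in> space P. window (k + k) \<eta> (n + int k) \<omega> \<in> ?S}"
      unfolding C_eq by (rule cylinder_mono[OF that])
    have "?N \<inter> C \<inter> ?R k = {\<omega> \<in> space P. sync (window k \<eta> n \<omega>) \<and> limit_number n \<omega> \<in> B \<and> window (k + k) \<eta> (n + int k) \<omega> \<in> ?S}"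
      unfolding C' by blast
    moreover have "C \<inter> ?R k = {\<omega> \<in> space P. sync (window k \<eta> n \<omega>) \<and> window (k + k) \<eta> (n + int k) \<omega> \<in> ?S}"
      unfolding C' by blast
    ultimately show ?thesis
      using number_given_sync_word[of k n B k ?S] by (simp only:)
  qed
  have "(\<lambda>k. M * measure P (?N \<inter> C \<inter> ?R k)) \<longlonglongrightarrow> M * measure P (?N \<inter> C)"
    by (intro tendsto_mult_left sync_probability_limit sets.Int limit_number_event CP)
  moreover have "(\<lambda>k. card (B \<inter> {1..M}) * measure P (C \<inter> ?R k)) \<longlonglongrightarrow> card (B \<inter> {1..M}) * measure P C"
    by (intro tendsto_mult_left sync_probability_limit CP)
  moreover have "\<forall>\<^sub>F k in sequentially. card (B \<inter> {1..M}) * measure P (C \<inter> ?R k) = M * measure P (?N \<inter> C \<inter> ?R k)"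
    unfolding eventually_sequentially using eq by (intro exI[of _ m]) simp
  ultimately show ?thesis
    by (rule LIMSEQ_unique[OF _ Lim_transform_eventually])
qed

end

end

section \<open>Uniformity, independence and the recovery of the past\<close>

lemma measurable_count_space_restrict:
  assumes "finite S" "f \<in> space N \<rightarrow> S" "f \<in> N \<rightarrow>\<^sub>M count_space UNIV"
  shows "f \<in> N \<rightarrow>\<^sub>M count_space S"
  unfolding measurable_count_space_eq2[OF assms(1)]
proof (intro conjI ballI assms(2))
  show "f -` {a} \<inter> space N \<in> sets N" for a
    by (rule measurable_sets[OF assms(3)]) simp
qed

lemma measurable_past_map:
  assumes F: "is_past_map d \<phi> F"
    and \<zeta>: "\<And>k. k \<le> n \<Longrightarrow> \<zeta> k \<in> N \<rightarrow>\<^sub>M count_space {-1, 1}"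
  shows "(\<lambda>\<omega>. F (past (\<lambda>k. \<zeta> k \<omega>) n)) \<in> N \<rightarrow>\<^sub>M count_space (recurrent_class d \<phi>)"
proof -
  have "F \<in> past_space \<rightarrow>\<^sub>M count_space (recurrent_class d \<phi>)"
    using F unfolding is_past_map_def by (rule conjunct1)
  moreover have "(\<lambda>\<omega>. past (\<lambda>k. \<zeta> k \<omega>) n) \<in> N \<rightarrow>\<^sub>M past_space"
    unfolding past_def past_space_def by (intro measurable_restrict \<zeta>) simp
  ultimately show ?thesis by (rule measurable_compose[rotated])
qed

context coin_driven_automaton
begin

text \<open>
  Every word is injective on a limit set, so once the state at time \<open>n\<close> is known, the twisted
  tosses can be undone one after the other.
\<close>

lemma window_pullback:
  assumes \<omega>: "\<omega> \<in> space P" and mem: "window d \<epsilon> (n - int j) \<omega> \<in> limit_set \<eta> (n - int j) \<omega>"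
  shows "window d \<epsilon> (n - int j) \<omega>
    = inv_into (limit_set \<eta> (n - int j) \<omega>) (act (window j \<eta> n \<omega>)) (window d \<epsilon> n \<omega>)"
proof -
  have "set (window j \<eta> n \<omega>) \<subseteq> {-1, 1}"
    using \<eta>_signs[OF \<omega>] unfolding window_def by auto
  then have "inj_on (act (window j \<eta> n \<omega>)) (limit_set \<eta> (n - int j) \<omega>)"
    unfolding limit_set_def by (rule sync_inj_on[OF sync_limit_word])
  then show ?thesis
    unfolding window_act[OF \<omega>, of n j] using mem by (rule inv_into_f_f[symmetric])
qed

lemma AE_window_in_limit_set: "AE \<omega> in P. \<forall>n. window d \<epsilon> n \<omega> \<in> limit_set \<eta> n \<omega>"
  using AE_sync[OF coin\<eta>] AE_space
proof eventually_elim
  case (elim \<omega>)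
  show ?case
  proof
    fix n
    obtain l where "sync (window l \<eta> n \<omega>)" using elim(1) by blast
    then show "window d \<epsilon> n \<omega> \<in> limit_set \<eta> n \<omega>"
      by (rule window_in_limit_set[OF elim(2)])
  qed
qed

context
  fixes num :: "int list set \<Rightarrow> int list \<Rightarrow> nat" and F :: "(int \<Rightarrow> int) \<Rightarrow> int list set"
  assumes num: "\<forall>A\<in>recurrent_class d \<phi>. bij_betw (num A) A {1..M}"
    and F: "is_past_map d \<phi> F"
begin

abbreviation "N \<equiv> state_number d \<phi> F num \<epsilon>"

lemma AE_state_set: "AE \<omega> in P. \<forall>n. state_set d \<phi> F \<epsilon> n \<omega> = limit_set \<eta> n \<omega>"
  using past_map_eq_limit_set[OF coin\<eta> F] by eventually_elim (simp add: state_set_def)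

lemma AE_state_number: "AE \<omega> in P. N n \<omega> = num (limit_set \<eta> n \<omega>) (window d \<epsilon> n \<omega>)"
  using AE_state_set by eventually_elim (simp add: state_number_def)

lemma measurable_state_number:
  assumes sp: "space K = space P"
    and \<epsilon>K: "\<And>k. k \<le> n \<Longrightarrow> \<epsilon> k \<in> K \<rightarrow>\<^sub>M count_space UNIV"
  shows "N n \<in> K \<rightarrow>\<^sub>M count_space UNIV"
  unfolding state_number_def[abs_def]
proof (rule measurable_compose_countable'[where f = "\<lambda>A \<omega>. num A (window d \<epsilon> n \<omega>)"])
  show "(\<lambda>\<omega>. num A (window d \<epsilon> n \<omega>)) \<in> K \<rightarrow>\<^sub>M count_space UNIV" for A
    by (rule measurable_compose[OF measurable_window[OF \<epsilon>K]]) simp_all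
  show "state_set d \<phi> F \<epsilon> n \<in> K \<rightarrow>\<^sub>M count_space (recurrent_class d \<phi>)"
    unfolding state_set_def[abs_def]
  proof (rule measurable_past_map[OF F])
    fix k assume "k \<le> n"
    then have "\<eta> k \<in> K \<rightarrow>\<^sub>M count_space UNIV"
      by (intro twist_measurable_past \<epsilon>K) simp
    then show "\<eta> k \<in> K \<rightarrow>\<^sub>M count_space {-1, 1}"
      by (rule measurable_count_space_restrict[rotated 2]) (use sp \<eta>_signs in auto)
  qed
  show "countable (recurrent_class d \<phi>)"
    by (rule countable_finite[OF finite_recurrent_class])
qed

lemma state_number_measurable: "N n \<in> P \<rightarrow>\<^sub>M count_space UNIV"
  by (rule measurable_state_number[OF refl \<epsilon>_meas])

text \<open>
  Both the law of the number and its independence are contained in this formula, since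
  \<open>card ({1..M} \<inter> B) / M\<close> is the uniform law of \<open>B\<close>.
\<close>

lemma state_number_joint:
  assumes C: "C \<in> cylinders n"
  shows "measure P ((N n -` B \<inter> space P) \<inter> C) = card ({1..M} \<inter> B) / M * measure P C"
proof -
  interpret prob_space P by (rule coin_tossing_prob_space[OF coin])
  have CP: "C \<in> sets P" using C cylinders_events by blast
  have "prob ((N n -` B \<inter> space P) \<inter> C)
      = prob ({\<omega> \<in> space P. num (limit_set \<eta> n \<omega>) (window d \<epsilon> n \<omega>) \<in> B} \<inter> C)"
  proof (rule finite_measure_eq_AE)
    show "AE \<omega> in P. (\<omega> \<in> (N n -` B \<inter> space P) \<inter> C)
        = (\<omega> \<in> {\<omega> \<in> space P. num (limit_set \<eta> n \<omega>) (window d \<epsilon> n \<omega>) \<in> B} \<inter> C)"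
      using AE_state_number[of n] by eventually_elim auto
    show "(N n -` B \<inter> space P) \<inter> C \<in> events"
      by (intro sets.Int CP measurable_sets[OF state_number_measurable]) simp
    show "{\<omega> \<in> space P. num (limit_set \<eta> n \<omega>) (window d \<epsilon> n \<omega>) \<in> B} \<inter> C \<in> events"
      by (intro sets.Int CP limit_number_event[OF num])
  qed
  moreover have "real M * prob ({\<omega> \<in> space P. num (limit_set \<eta> n \<omega>) (window d \<epsilon> n \<omega>) \<in> B} \<inter> C)
      = card ({1..M} \<inter> B) * prob C"
    using limit_number_indep[OF num C, of B] by (simp only: Int_commute)
  ultimately show ?thesis
    using M_pos by (simp add: field_simps)
qed

lemma state_number_prob: "measure P (N n -` B \<inter> space P) = card ({1..M} \<inter> B) / M"
proof -
  interpret prob_space P by (rule coin_tossing_prob_space[OF coin])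
  have "space P = {\<omega> \<in> space P. window (0 + 0) \<eta> (n + int 0) \<omega> \<in> UNIV}" by simp
  then have "space P \<in> cylinders n" unfolding cylinders_def by blast
  from state_number_joint[OF this, of B] show ?thesis
    by (simp add: prob_space Int_assoc)
qed

theorem state_number_uniform:
  "distr P (count_space UNIV) (N n) = measure_pmf (pmf_of_set {1..M})"
proof (rule measure_eqI)
  interpret prob_space P by (rule coin_tossing_prob_space[OF coin])
  fix B
  have ne: "{1..M} \<noteq> {}" using M_pos by simp
  show "emeasure (distr P (count_space UNIV) (N n)) B = emeasure (measure_pmf (pmf_of_set {1..M})) B"
    unfolding emeasure_pmf_of_set[OF ne finite_atLeastAtMost] using state_number_measurable[of n]
    by (simp add: emeasure_distr emeasure_eq_measure state_number_prob)
qed simp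

theorem state_number_indep:
  "prob_space.indep_set (completion P) (var_field P (N n)) (full_field P \<eta>)"
proof -
  interpret prob_space P by (rule coin_tossing_prob_space[OF coin])
  interpret C: prob_space "completion P" by (rule prob_space_completion)
  let ?A = "{N n -` B \<inter> space P | B. True}"
  have ind: "C.indep_set (completed_field P ?A) (completed_field P (cylinders n))"
  proof (rule indep_set_completed)
    show "?A \<subseteq> events" by (auto intro: measurable_sets[OF state_number_measurable])
    show "Int_stable ?A"
    proof (rule Int_stableI)
      fix a b assume "a \<in> ?A" "b \<in> ?A"
      then obtain B B' where "a = N n -` B \<inter> space P" "b = N n -` B' \<inter> space P" by blast
      then have "a \<inter> b = N n -` (B \<inter> B') \<inter> space P" by blast
      then show "a \<inter> b \<in> ?A" by blast
    qed
    fix a b assume "a \<in> ?A" and b: "b \<in> cylinders n"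
    then obtain B where a: "a = N n -` B \<inter> space P" by blast
    show "prob (a \<inter> b) = prob a * prob b"
      unfolding a state_number_joint[OF b] state_number_prob ..
  qed (rule cylinders_events cylinders_Int_stable)+
  have "full_field P \<eta> \<subseteq> completed_field P (cylinders n)"
    unfolding full_field_def
  proof (rule completed_field_subset, safe)
    fix k :: int and B :: "int set"
    define m where "m = nat (\<bar>k - n\<bar> + 1)"
    have "n + int m - int (m + m) + 1 + int (nat (k - n + int m - 1)) = k"
      "nat (k - n + int m - 1) < m + m"
      unfolding m_def by linarith+
    then have nth: "window (m + m) \<eta> (n + int m) \<omega> ! nat (k - n + int m - 1) = \<eta> k \<omega>" for \<omega>
      by (simp add: window_nth)
    have "\<eta> k -` B \<inter> space P
        = {\<omega> \<in> space P. window (m + m) \<eta> (n + int m) \<omega> \<in> {u. u ! nat (k - n + int m - 1) \<in> B}}"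
      using nth by auto
    then have "\<eta> k -` B \<inter> space P \<in> cylinders n"
      unfolding cylinders_def by blast
    then show "\<eta> k -` B \<inter> space P \<in> completed_field P (cylinders n)"
      using subset_completed_field by blast
  qed
  then show ?thesis
    using ind unfolding C.indep_sets2_eq var_field_def by blast
qed

text \<open>
  The windows and hence the number are functions of the past of \<open>\<epsilon>\<close>. Conversely, up to null sets,
  the number and the limit set determine the window at time \<open>n\<close>, the earlier windows are obtained
  by pulling it back through the limit sets, and each toss is the last entry of its window.
\<close>

theorem past_field_recovered:
  "past_field P \<epsilon> n = join_field P (past_field P \<eta> n) (var_field P (N n))"
proof
  let ?G = "{\<epsilon> k -` B \<inter> space P | k B. k \<le> n}" and ?H = "past_field P \<eta> n \<union> var_field P (N n)"
  have pow: "completed_field P A \<subseteq> Pow (space P)" if "A \<subseteq> Pow (space P)" for A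
    using sets.space_closed[of "completed_measure P A"] completed_measure_simps[OF that] by simp
  have G: "?G \<subseteq> Pow (space P)" by blast
  have H: "?H \<subseteq> Pow (space P)"
    unfolding past_field_def var_field_def by (intro Un_least pow) blast+
  have sets_G: "sets (completed_measure P ?G) = past_field P \<epsilon> n"
    unfolding past_field_def by (rule completed_measure_simps(2)[OF G])
  have sets_H: "sets (completed_measure P ?H) = join_field P (past_field P \<eta> n) (var_field P (N n))"
    unfolding join_field_def by (rule completed_measure_simps(2)[OF H])
  note sp_G = completed_measure_simps(1)[OF G] and sp_H = completed_measure_simps(1)[OF H]
  show "join_field P (past_field P \<eta> n) (var_field P (N n)) \<subseteq> past_field P \<epsilon> n"
  proof -
    have \<epsilon>: "\<epsilon> k \<in> completed_measure P ?G \<rightarrow>\<^sub>M count_space UNIV" if "k \<le> n" for k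
    proof (rule measurableI)
      fix B
      have "\<epsilon> k -` B \<inter> space P \<in> ?G" using that by blast
      then show "\<epsilon> k -` B \<inter> space (completed_measure P ?G) \<in> sets (completed_measure P ?G)"
        unfolding sp_G completed_measure_simps(2)[OF G] by (rule subsetD[OF subset_completed_field])
    qed simp
    have "past_field P \<eta> n \<subseteq> past_field P \<epsilon> n"
      unfolding past_field_def
    proof (rule completed_field_subset, safe)
      fix k :: int and B :: "int set" assume k: "k \<le> n"
      have "\<eta> k \<in> completed_measure P ?G \<rightarrow>\<^sub>M count_space UNIV"
        by (intro twist_measurable_past \<epsilon> order.trans[OF _ k])
      then have "\<eta> k -` B \<inter> space (completed_measure P ?G) \<in> sets (completed_measure P ?G)"
        by (rule measurable_sets) simp
      then show "\<eta> k -` B \<inter> space P \<in> completed_field P ?G"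
        unfolding sp_G completed_measure_simps(2)[OF G] .
    qed
    moreover have "var_field P (N n) \<subseteq> past_field P \<epsilon> n"
      unfolding var_field_def past_field_def
    proof (rule completed_field_subset, safe)
      fix B :: "nat set"
      have "N n \<in> completed_measure P ?G \<rightarrow>\<^sub>M count_space UNIV"
        by (rule measurable_state_number[OF sp_G \<epsilon>])
      then have "N n -` B \<inter> space (completed_measure P ?G) \<in> sets (completed_measure P ?G)"
        by (rule measurable_sets) simp
      then show "N n -` B \<inter> space P \<in> completed_field P ?G"
        unfolding sp_G completed_measure_simps(2)[OF G] .
    qed
    ultimately show ?thesis
      unfolding join_field_def past_field_def[of P \<epsilon>] by (intro completed_field_subset Un_least)
  qed
  show "past_field P \<epsilon> n \<subseteq> join_field P (past_field P \<eta> n) (var_field P (N n))"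
    unfolding past_field_def[of P \<epsilon>] join_field_def
  proof (rule completed_field_subset, safe)
    fix k :: int and B :: "int set" assume k: "k \<le> n"
    let ?K = "completed_measure P ?H"
    define j where "j = nat (n - k)"
    have k_eq: "k = n - int j" using k by (simp add: j_def)
    have in_K: "A \<in> sets ?K" if "A \<in> ?H" for A
      unfolding completed_measure_simps(2)[OF H] using that by (rule subsetD[OF subset_completed_field])
    have \<eta>K: "\<eta> i \<in> ?K \<rightarrow>\<^sub>M count_space UNIV" if "i \<le> n" for i
    proof (rule measurableI)
      fix B
      have "\<eta> i -` B \<inter> space P \<in> past_field P \<eta> n"
        unfolding past_field_def using that by (intro subsetD[OF subset_completed_field]) blast
      then show "\<eta> i -` B \<inter> space ?K \<in> sets ?K"
        unfolding sp_H by (intro in_K UnI1)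
    qed simp
    have NK: "N n \<in> ?K \<rightarrow>\<^sub>M count_space UNIV"
    proof (rule measurableI)
      fix B
      have "N n -` B \<inter> space P \<in> var_field P (N n)"
        unfolding var_field_def by (intro subsetD[OF subset_completed_field]) blast
      then show "N n -` B \<inter> space ?K \<in> sets ?K"
        unfolding sp_H by (intro in_K UnI2)
    qed simp
    have LK: "limit_set \<eta> i \<in> ?K \<rightarrow>\<^sub>M count_space (recurrent_class d \<phi>)" if "i \<le> n" for i
      using that by (intro measurable_limit_set \<eta>K) simp
    have WK: "window j \<eta> n \<in> ?K \<rightarrow>\<^sub>M count_space UNIV"
      by (rule measurable_window[OF \<eta>K])
    note fin = countable_finite[OF finite_recurrent_class]
    \<comment> \<open>Decoding: number to window at time \<open>n\<close>, then to the window at time \<open>k\<close>, then to the toss.\<close>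
    let ?f = "\<lambda>A A' w i. last (inv_into A (act w) (inv_into A' (num A') i))"
    let ?g = "\<lambda>\<omega>. ?f (limit_set \<eta> k \<omega>) (limit_set \<eta> n \<omega>) (window j \<eta> n \<omega>) (N n \<omega>)"
    have "(\<lambda>\<omega>. ?f A A' w (N n \<omega>)) \<in> ?K \<rightarrow>\<^sub>M count_space UNIV" for A A' w
      by (rule measurable_compose[OF NK]) simp
    then have "(\<lambda>\<omega>. ?f A A' (window j \<eta> n \<omega>) (N n \<omega>)) \<in> ?K \<rightarrow>\<^sub>M count_space UNIV" for A A'
      by (rule measurable_compose_countable[OF _ WK])
    then have "(\<lambda>\<omega>. ?f A (limit_set \<eta> n \<omega>) (window j \<eta> n \<omega>) (N n \<omega>)) \<in> ?K \<rightarrow>\<^sub>M count_space UNIV" for A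
      by (rule measurable_compose_countable'[OF _ LK[OF order.refl] fin])
    then have g: "?g \<in> ?K \<rightarrow>\<^sub>M count_space UNIV"
      by (rule measurable_compose_countable'[OF _ LK[OF k] fin])
    have "AE \<omega> in P. \<epsilon> k \<omega> = ?g \<omega>"
      using AE_window_in_limit_set AE_state_number[of n] AE_space
    proof eventually_elim
      case (elim \<omega>)
      have "inj_on (num (limit_set \<eta> n \<omega>)) (limit_set \<eta> n \<omega>)"
        by (rule bij_betw_imp_inj_on[OF bspec[OF num limit_set_recurrent]])
      then have "inv_into (limit_set \<eta> n \<omega>) (num (limit_set \<eta> n \<omega>)) (N n \<omega>) = window d \<epsilon> n \<omega>"
        unfolding elim(2) by (rule inv_into_f_f) (rule elim(1)[THEN spec])
      moreover have "window d \<epsilon> k \<omega> = inv_into (limit_set \<eta> k \<omega>) (act (window j \<eta> n \<omega>)) (window d \<epsilon> n \<omega>)"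
        unfolding k_eq by (rule window_pullback[OF elim(3) elim(1)[THEN spec]])
      moreover have "\<epsilon> k \<omega> = last (window d \<epsilon> k \<omega>)"
        by (subst window_tl) simp
      ultimately show ?case by simp
    qed
    moreover have "null_sets (completion P) \<subseteq> sets ?K"
      unfolding completed_measure_simps(2)[OF H] by (rule null_sets_completed_field)
    ultimately have "\<epsilon> k \<in> ?K \<rightarrow>\<^sub>M count_space UNIV"
      by (intro measurable_completed_AE[OF sp_H _ g])
    then have "\<epsilon> k -` B \<inter> space (completed_measure P ?H) \<in> sets (completed_measure P ?H)"
      by (rule measurable_sets) simp
    then show "\<epsilon> k -` B \<inter> space P \<in> completed_field P ?H"
      unfolding sp_H completed_measure_simps(2)[OF H] .
  qed
qed

end

end

theorem corollary22:
  fixes d :: nat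
    and \<phi> :: "int list \<Rightarrow> int"
    and P :: "'a measure"
    and \<epsilon> :: "int \<Rightarrow> 'a \<Rightarrow> int"
    and F :: "(int \<Rightarrow> int) \<Rightarrow> int list set"
    and num :: "int list set \<Rightarrow> int list \<Rightarrow> nat"
    and n :: int
  assumes "d \<ge> 1"
    and "\<phi> \<in> cube d \<rightarrow> {-1, 1}"
    and "coin_tossing P \<epsilon>"
    and "is_past_map d \<phi> F"
    and "\<forall>A\<in>recurrent_class d \<phi>. bij_betw (num A) A {1..max_nonaccordable d \<phi>}"
  shows "(AE \<omega> in P. window d \<epsilon> n \<omega> \<in> state_set d \<phi> F \<epsilon> n \<omega>)
    \<and> state_number d \<phi> F num \<epsilon> n \<in> P \<rightarrow>\<^sub>M count_space UNIV
    \<and> distr P (count_space UNIV) (state_number d \<phi> F num \<epsilon> n)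
        = measure_pmf (pmf_of_set {1..max_nonaccordable d \<phi>})
    \<and> prob_space.indep_set (completion P)
        (var_field P (state_number d \<phi> F num \<epsilon> n)) (full_field P (twist d \<phi> \<epsilon>))
    \<and> past_field P \<epsilon> n
        = join_field P (past_field P (twist d \<phi> \<epsilon>) n)
            (var_field P (state_number d \<phi> F num \<epsilon> n))"
proof -
  interpret coin_driven_automaton d \<phi> P \<epsilon>
    using assms(1-3) by unfold_locales
  note num = assms(5) and F = assms(4)
  have "AE \<omega> in P. window d \<epsilon> n \<omega> \<in> state_set d \<phi> F \<epsilon> n \<omega>"
    using AE_window_in_limit_set AE_state_set[OF num F] by eventually_elim simp
  then show ?thesis
    by (intro conjI state_number_measurable[OF num F] state_number_uniform[OF num F]
        state_number_indep[OF num F] past_field_recovered[OF num F])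
qed

end
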